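(* Let $k_0\geq 1$ be an integer. Then the polynomial $$q(\alpha)=(\alpha-1)-\alpha^{2}(\alpha+3)k_{0}^{2}$$ has one and only one real root (with multiplicity one), denoted $\alpha_0$. Moreover, the coordinate-free flame front model with normal velocity $U$ given by $$-U=1+(\alpha-1)\kappa+\alpha^2(\alpha+3)\kappa_{ss}+\left(1+\frac{\alpha}{2}\right)\kappa^2+\left(2\alpha+5\alpha^2-\frac{\alpha^3}{3}\right)\kappa^3$$ has infinitely many vertically traveling solutions, i.e. solutions satisfying $U=-\beta\cos(\theta)$ and $V=-\beta\sin(\theta)$, in the neighbourhood of $(\theta,\beta,\alpha)=(0,1,\alpha_0)$. That is, with $$F(\theta,\beta;\alpha)=1+(\alpha-1)\frac{\theta_\sigma}{s_\sigma}+\left(1+\frac{\alpha}{2}\right)\frac{\theta_\sigma^2}{s_\sigma^2}+\left(2\alpha+5\alpha^2-\frac{\alpha^3}{3}\right)\frac{\theta_\sigma^3}{s_\sigma^3}+\alpha^2(\alpha+3)\frac{\theta_{\sigma\sigma\sigma}}{s_\sigma^3}-\beta\cos(\theta),$$ there exist $\delta>0$ and a nontrivial continuously differentiable curve $$\{(\theta(\varpi),\beta(\varpi),\alpha(\varpi)):\ \varpi\in(-\delta,\delta)\}\subset H^3_{\mathrm{odd}}\times\mathbb{R}\times\mathbb{R},\qquad (\theta(0),\beta(0),\alpha(0))=(0,1,\alpha_0),$$ such that $F(\theta(\varpi),\beta(\varpi);\alpha(\varpi))=0$ for all $\varpi\in(-\delta,\delta)$.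
   Context: The flame front is a planar curve $(x(\sigma,t),y(\sigma,t))$, horizontally periodic: $x(\sigma+2\pi,t)=x(\sigma,t)+2\pi$, $y(\sigma+2\pi,t)=y(\sigma,t)$. It moves by $(x,y)_t=U\mathbf{\hat n}+V\mathbf{\hat t}$, where $\theta$ is the tangent angle the curve forms with the horizontal, $\mathbf{\hat t}=(\cos\theta,\sin\theta)$, $\mathbf{\hat n}=(-\sin\theta,\cos\theta)$, $U$ is the normal velocity and $V$ the tangential velocity. Here $\kappa=\theta_\sigma/s_\sigma$ is the curvature, $s$ is arclength, $\frac{d}{ds}=\frac{1}{s_\sigma}\frac{d}{d\sigma}$, and $\alpha\in\mathbb{R}$ is a parameter. A vertically traveling solution with velocity $(0,-\beta)$, $\beta\in\mathbb{R}$, is one with $(x_t,y_t)=(0,-\beta)$; equivalently $U=-\beta\cos(\theta)$ and $V=-\beta\sin(\theta)$. The curve is parameterized by normalized arclength, so $(x_\sigma,y_\sigma)=\frac{L}{2\pi}(\cos\theta(\sigma),\sin\theta(\sigma))$ and $s_\sigma=\frac{L}{2\pi}$ is independent of $\sigma$, where $L$ is the length of one period of the curve. By periodicity $L$ is determined by $\theta$: $$L=\frac{4\pi^2}{\int_0^{2\pi}\cos(\theta(\sigma))\,d\sigma},\qquad\text{so}\qquad s_\sigma=\frac{2\pi}{\int_0^{2\pi}\cos(\theta(\sigma))\,d\sigma}$$ (considered for $\theta$ near $0$, where the integral is positive). The unknown is $\theta$, and with $V=-\beta\sin\theta$ fixing the parameterization, the vertically traveling waves are the solutions of $F(\theta,\beta;\alpha)=0$.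 $H^3_{\mathrm{odd}}$ denotes the Sobolev space $H^3$ of real $2\pi$-periodic functions of $\sigma$, restricted to those with Fourier sine series expansions; $L^2_{\mathrm{even}}$ denotes the $2\pi$-periodic $L^2$ functions with Fourier cosine series expansions. $F$ takes $(\theta,\beta,\alpha)\in H^3_{\mathrm{odd}}\times\mathbb{R}\times\mathbb{R}$ (with $\theta$ near $0$) to $L^2_{\mathrm{even}}$. The trivial solutions are $(\theta,\beta,\alpha)=(0,1,\alpha)$, $\alpha\in\mathbb{R}$, for which $F=0$; "nontrivial curve" is meant in the usual sense of bifurcation theory: apart from the point $\varpi=0$, the points of the curve are not trivial solutions. *)

theory Defs
  imports "HOL-Analysis.Analysis" "HOL-Computational_Algebra.Polynomial"
begin

section \<open>Periodic Sobolev functions\<close>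

definition L2_per :: "(real \<Rightarrow> real) set" where
  "L2_per = {f. f \<in> borel_measurable borel \<and> (\<forall>x. f (x + 2 * pi) = f x) \<and>
     (\<forall>a b. set_integrable lborel {a..b} (\<lambda>x. (f x)\<^sup>2))}"

text \<open>
  In one dimension, a continuous function \<open>f\<close> has the weak derivative \<open>g\<close> iff \<open>f\<close> is an
  indefinite integral of \<open>g\<close>. This determines \<open>g\<close> up to a null set only.
\<close>

definition is_weak_deriv :: "(real \<Rightarrow> real) \<Rightarrow> (real \<Rightarrow> real) \<Rightarrow> bool" where
  "is_weak_deriv f g \<longleftrightarrow> g \<in> L2_per \<and> (\<forall>a b. a \<le> b \<longrightarrow> f b - f a = (LBINT x:{a..b}. g x))"

definition weak_deriv :: "(real \<Rightarrow> real) \<Rightarrow> real \<Rightarrow> real" where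
  "weak_deriv f = (SOME g. is_weak_deriv f g)"

text \<open>
  An element of \<open>H\<^sup>3\<close> is represented by its unique continuous representative, which is
  twice continuously differentiable; its second derivative is absolutely continuous with
  (weak) derivative in \<open>L\<^sup>2\<close>.
\<close>

definition H3_per :: "(real \<Rightarrow> real) set" where
  "H3_per = {f. (\<forall>x. f (x + 2 * pi) = f x) \<and>
     (\<forall>x. f differentiable (at x)) \<and>
     (\<forall>x. deriv f differentiable (at x)) \<and>
     (\<exists>g. is_weak_deriv (deriv (deriv f)) g)}"

text \<open>The Fourier series has no constant and no cosine terms.\<close>

definition sine_series :: "(real \<Rightarrow> real) set" where
  "sine_series = {f. \<forall>n::nat. (LBINT x:{0..2*pi}. f x * cos (real n * x)) = 0}"

definition L2_inner :: "(real \<Rightarrow> real) \<Rightarrow> (real \<Rightarrow> real) \<Rightarrow> real" where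
  "L2_inner f g = (LBINT x:{0..2*pi}. f x * g x)"

definition H3_inner :: "(real \<Rightarrow> real) \<Rightarrow> (real \<Rightarrow> real) \<Rightarrow> real" where
  "H3_inner f g = L2_inner f g + L2_inner (deriv f) (deriv g)
     + L2_inner (deriv (deriv f)) (deriv (deriv g))
     + L2_inner (weak_deriv (deriv (deriv f))) (weak_deriv (deriv (deriv g)))"

subsection \<open>Auxiliary facts\<close>

lemma L2_set_integrable_mult:
  assumes "f \<in> L2_per" "g \<in> L2_per"
  shows "set_integrable lborel {a..b} (\<lambda>x. f x * g x)"
proof -
  have [measurable]: "f \<in> borel_measurable borel" "g \<in> borel_measurable borel"
    using assms by (auto simp: L2_per_def)
  have "set_integrable lborel {a..b} (\<lambda>x. (f x)\<^sup>2 + (g x)\<^sup>2)"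
    using assms by (intro set_integral_add(1)) (auto simp: L2_per_def)
  then show ?thesis
  proof (rule set_integrable_bound)
    show "set_borel_measurable lborel {a..b} (\<lambda>x. f x * g x)"
      unfolding set_borel_measurable_def by measurable
    show "AE x in lborel. x \<in> {a..b} \<longrightarrow> norm (f x * g x) \<le> norm ((f x)\<^sup>2 + (g x)\<^sup>2)"
    proof (intro always_eventually allI impI)
      fix x
      have "2 * \<bar>f x * g x\<bar> \<le> (f x)\<^sup>2 + (g x)\<^sup>2"
        using sum_squares_bound[of "\<bar>f x\<bar>" "\<bar>g x\<bar>"] by (simp add: abs_mult)
      then show "norm (f x * g x) \<le> norm ((f x)\<^sup>2 + (g x)\<^sup>2)"
        by simp
    qed
  qed
qed

lemma continuous_in_L2_per:
  assumes "\<And>x. isCont f x" "\<And>x. f (x + 2 * pi) = f x"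
  shows "f \<in> L2_per"
proof -
  have c: "continuous_on UNIV f"
    using assms(1) by (simp add: continuous_on_eq_continuous_at)
  have "set_integrable lborel {a..b} (\<lambda>x. (f x)\<^sup>2)" for a b
    by (intro borel_integrable_atLeastAtMost'[unfolded set_integrable_def[symmetric]]
          continuous_intros continuous_on_subset[OF c]) auto
  then show ?thesis
    using assms(2) borel_measurable_continuous_onI[OF c] by (simp add: L2_per_def)
qed

lemma const_in_L2_per: "(\<lambda>_. c) \<in> L2_per"
  by (rule continuous_in_L2_per) auto

lemma L2_set_integrable:
  assumes "f \<in> L2_per"
  shows "set_integrable lborel {a..b} f"
  using L2_set_integrable_mult[OF assms const_in_L2_per[of 1]] by simp

lemma L2_per_lincomb:
  assumes "f \<in> L2_per" "g \<in> L2_per"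
  shows "(\<lambda>x. a * f x + b * g x) \<in> L2_per"
proof -
  have [measurable]: "f \<in> borel_measurable borel" "g \<in> borel_measurable borel"
    using assms by (auto simp: L2_per_def)
  have "set_integrable lborel {c..d} (\<lambda>x. a^2 * (f x * f x) + (2 * a * b) * (f x * g x) + b^2 * (g x * g x))" for c d
    using L2_set_integrable_mult[OF assms(1) assms(1)] L2_set_integrable_mult[OF assms]
      L2_set_integrable_mult[OF assms(2) assms(2)]
    by (intro set_integral_add(1) set_integrable_mult_right) auto
  moreover have "a^2 * (f x * f x) + (2 * a * b) * (f x * g x) + b^2 * (g x * g x) = (a * f x + b * g x)\<^sup>2" for x
    by (simp add: power2_eq_square algebra_simps)
  ultimately show ?thesis
    using assms by (simp add: L2_per_def)
qed

lemma is_weak_deriv_lincomb: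
  assumes "is_weak_deriv f f'" "is_weak_deriv g g'"
  shows "is_weak_deriv (\<lambda>x. a * f x + b * g x) (\<lambda>x. a * f' x + b * g' x)"
  unfolding is_weak_deriv_def
proof (intro conjI allI impI)
  have L: "f' \<in> L2_per" "g' \<in> L2_per"
    using assms by (auto simp: is_weak_deriv_def)
  show "(\<lambda>x. a * f' x + b * g' x) \<in> L2_per"
    by (rule L2_per_lincomb[OF L])
  fix c d :: real assume "c \<le> d"
  then have "f d - f c = (LBINT x:{c..d}. f' x)" "g d - g c = (LBINT x:{c..d}. g' x)"
    using assms by (auto simp: is_weak_deriv_def)
  moreover have "(LBINT x:{c..d}. a * f' x + b * g' x)
      = a * (LBINT x:{c..d}. f' x) + b * (LBINT x:{c..d}. g' x)"
    using L2_set_integrable[OF L(1)] L2_set_integrable[OF L(2)]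
    by (subst set_integral_add(2)) auto
  moreover have "a * f d + b * g d - (a * f c + b * g c) = a * (f d - f c) + b * (g d - g c)"
    by (simp add: algebra_simps)
  ultimately show "a * f d + b * g d - (a * f c + b * g c) = (LBINT x:{c..d}. a * f' x + b * g' x)"
    by simp
qed

lemma AE_eq_0_if_tails_eq_0:
  fixes w :: "real \<Rightarrow> real"
  assumes w: "integrable lborel w" and tails: "\<And>x. (LBINT y:{x<..}. w y) = 0"
  shows "AE x in lborel. w x = 0"
proof -
  define p m where "p = (\<lambda>x. max 0 (w x))" and "m = (\<lambda>x. max 0 (- w x))"
  have p: "integrable lborel p" and m: "integrable lborel m"
    unfolding p_def m_def using w by auto
  have [measurable]: "p \<in> borel_measurable borel" "m \<in> borel_measurable borel"
    using p m by (auto dest: borel_measurable_integrable)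
  have em: "emeasure (density lborel (\<lambda>y. ennreal (q y))) {x<..} = ennreal (LBINT y:{x<..}. q y)"
    if q: "integrable lborel q" "\<And>y. 0 \<le> q y" for q :: "real \<Rightarrow> real" and x
  proof -
    have [measurable]: "q \<in> borel_measurable borel"
      using q by (auto dest: borel_measurable_integrable)
    have i: "set_integrable lborel {x<..} q"
      using q(1) unfolding set_integrable_def
      by (intro integrable_mult_indicator) auto
    have "emeasure (density lborel (\<lambda>y. ennreal (q y))) {x<..} = (\<integral>\<^sup>+y. ennreal (q y) * indicator {x<..} y \<partial>lborel)"
      by (subst emeasure_density) auto
    also have "\<dots> = (\<integral>\<^sup>+y. ennreal (indicator {x<..} y *\<^sub>R q y) \<partial>lborel)"
      by (intro nn_integral_cong) (auto simp: indicator_def)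
    also have "\<dots> = ennreal (LBINT y:{x<..}. q y)"
      unfolding set_lebesgue_integral_def using i q(2)
      by (intro nn_integral_eq_integral) (auto simp: set_integrable_def indicator_def)
    finally show ?thesis .
  qed
  have si: "set_integrable lborel {x<..} p" "set_integrable lborel {x<..} m" for x
    unfolding set_integrable_def by (intro integrable_mult_indicator p m; simp)+
  have eq: "(LBINT y:{x<..}. p y) = (LBINT y:{x<..}. m y)" for x
  proof -
    have "(LBINT y:{x<..}. p y) - (LBINT y:{x<..}. m y) = (LBINT y:{x<..}. p y - m y)"
      by (rule set_integral_diff(2)[symmetric]) (fact si)+
    also have "(\<lambda>y. p y - m y) = w"
      by (auto simp: p_def m_def)
    finally show ?thesis using tails[of x] by simp
  qed
  have "density lborel (\<lambda>y. ennreal (p y)) = density lborel (\<lambda>y. ennreal (m y))"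
    using em[OF p] em[OF m] eq by (intro measure_eqI_lessThan) (auto simp: p_def m_def)
  then have "AE x in lborel. ennreal (p x) = ennreal (m x)"
    by (intro sigma_finite_measure.density_unique[OF sigma_finite_lborel]) auto
  then show ?thesis
    by eventually_elim (auto simp: p_def m_def max_def split: if_splits)
qed

lemma is_weak_deriv_unique:
  assumes g: "is_weak_deriv f g" and h: "is_weak_deriv f h"
  shows "AE x in lborel. g x = h x"
proof -
  define u where "u = (\<lambda>x. g x - h x)"
  have L: "g \<in> L2_per" "h \<in> L2_per"
    using g h by (auto simp: is_weak_deriv_def)
  have u: "set_integrable lborel {a..b} u" for a b
    unfolding u_def by (intro set_integral_diff(1) L2_set_integrable L)
  have u0: "(LBINT x:{a..b}. u x) = 0" if "a \<le> b" for a b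
    unfolding u_def using g h that L2_set_integrable[OF L(1)] L2_set_integrable[OF L(2)]
    by (subst set_integral_diff(2)) (auto simp: is_weak_deriv_def)
  have "AE x in lborel. indicator {-real n..real n} x *\<^sub>R u x = 0" for n :: nat
  proof (rule AE_eq_0_if_tails_eq_0)
    show "integrable lborel (\<lambda>x. indicator {-real n..real n} x *\<^sub>R u x)"
      using u unfolding set_integrable_def .
    fix x :: real
    have "(LBINT y:{x<..}. indicator {-real n..real n} y *\<^sub>R u y)
       = (LBINT y:{max x (-real n)..real n}. u y)"
      unfolding set_lebesgue_integral_def
    proof (rule integral_cong_AE)
      have um: "(\<lambda>y. u y) \<in> borel_measurable borel"
        using L by (auto simp: u_def L2_per_def)
      show "AE y in lborel. indicator {x<..} y *\<^sub>R indicator {-real n..real n} y *\<^sub>R u y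
          = indicator {max x (- real n)..real n} y *\<^sub>R u y"
        using AE_lborel_singleton[of x] by eventually_elim (auto simp: indicator_def)
    qed (use L in \<open>auto simp: u_def L2_per_def\<close>)
    also have "\<dots> = 0"
    proof (cases "max x (-real n) \<le> real n")
      case False
      then have "{max x (-real n)..real n} = {}" by auto
      then show ?thesis by (simp add: set_lebesgue_integral_def del: atLeastatMost_empty_iff)
    qed (rule u0)
    finally show "(LBINT y:{x<..}. indicator {-real n..real n} y *\<^sub>R u y) = 0" .
  qed
  then have "AE x in lborel. \<forall>n::nat. indicator {-real n..real n} x *\<^sub>R u x = 0"
    by (subst AE_all_countable) blast
  then show ?thesis
  proof eventually_elim
    fix x assume *: "\<forall>n::nat. indicator {-real n..real n} x *\<^sub>R u x = 0"
    obtain n :: nat where "\<bar>x\<bar> \<le> real n" using real_arch_simple by blast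
    then have "x \<in> {-real n..real n}" by auto
    then show "g x = h x" using *[rule_format, of n] by (simp add: u_def)
  qed
qed

lemma is_weak_deriv_weak_deriv: "is_weak_deriv f g \<Longrightarrow> is_weak_deriv f (weak_deriv f)"
  unfolding weak_deriv_def by (rule someI[of "is_weak_deriv f"])

lemma deriv_lincomb:
  fixes f g :: "real \<Rightarrow> real"
  assumes "\<And>x. f differentiable (at x)" "\<And>x. g differentiable (at x)"
  shows "deriv (\<lambda>x. a * f x + b * g x) = (\<lambda>x. a * deriv f x + b * deriv g x)"
proof
  fix x
  have "((\<lambda>x. a * f x + b * g x) has_field_derivative (a * deriv f x + b * deriv g x)) (at x)"
    using assms by (intro DERIV_add DERIV_cmult) (simp_all add: DERIV_deriv_iff_real_differentiable)
  then show "deriv (\<lambda>x. a * f x + b * g x) x = a * deriv f x + b * deriv g x"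
    by (rule DERIV_imp_deriv)
qed

lemma deriv_periodic:
  fixes f :: "real \<Rightarrow> real"
  assumes "\<And>x. f differentiable (at x)" "\<And>x. f (x + 2 * pi) = f x"
  shows "deriv f (x + 2 * pi) = deriv f x"
proof -
  have "(f has_field_derivative deriv f (x + 2 * pi)) (at (x + 2 * pi))"
    using assms(1) by (simp add: DERIV_deriv_iff_real_differentiable)
  then have "((\<lambda>x. f (x + 2 * pi)) has_field_derivative deriv f (x + 2 * pi)) (at x)"
    by (simp add: DERIV_shift)
  then show ?thesis
    using assms(2) by (simp add: DERIV_imp_deriv)
qed

lemma is_weak_deriv_imp_isCont:
  assumes "is_weak_deriv f g"
  shows "isCont f x"
proof -
  have g: "g \<in> L2_per" and f: "\<And>a b. a \<le> b \<Longrightarrow> f b - f a = (LBINT x:{a..b}. g x)"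
    using assms by (auto simp: is_weak_deriv_def)
  have I: "g integrable_on {x-1..x+1}"
    using set_borel_integral_eq_integral(1)[OF L2_set_integrable[OF g]] .
  have "continuous_on {x-1..x+1} (\<lambda>y. f (x-1) + integral {x-1..y} g)"
    by (intro continuous_intros indefinite_integral_continuous_1 I)
  moreover have "f (x-1) + integral {x-1..y} g = f y" if "y \<in> {x-1..x+1}" for y
    using f[of "x-1" y] that set_borel_integral_eq_integral(2)[OF L2_set_integrable[OF g], of "x-1" y]
    by auto
  ultimately have "continuous_on {x-1..x+1} f"
    by (rule continuous_on_eq)
  then show ?thesis
    by (rule continuous_on_interior) auto
qed

lemma H3_per_L2:
  assumes "f \<in> H3_per"
  shows "f \<in> L2_per" "deriv f \<in> L2_per" "deriv (deriv f) \<in> L2_per"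
    "weak_deriv (deriv (deriv f)) \<in> L2_per"
    "is_weak_deriv (deriv (deriv f)) (weak_deriv (deriv (deriv f)))"
proof -
  have d: "\<And>x. f differentiable (at x)" "\<And>x. deriv f differentiable (at x)"
    and per: "\<And>x. f (x + 2 * pi) = f x" and w: "\<exists>g. is_weak_deriv (deriv (deriv f)) g"
    using assms by (auto simp: H3_per_def)
  have per1: "\<And>x. deriv f (x + 2 * pi) = deriv f x"
    by (rule deriv_periodic[OF d(1) per])
  have per2: "\<And>x. deriv (deriv f) (x + 2 * pi) = deriv (deriv f) x"
    by (rule deriv_periodic[OF d(2) per1])
  show "f \<in> L2_per" using d(1) per
    by (intro continuous_in_L2_per) (auto intro: differentiable_imp_continuous_within)
  show "deriv f \<in> L2_per" using d(2) per1
    by (intro continuous_in_L2_per) (auto intro: differentiable_imp_continuous_within)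
  show "deriv (deriv f) \<in> L2_per" using w per2
    by (intro continuous_in_L2_per) (auto intro: is_weak_deriv_imp_isCont)
  show *: "is_weak_deriv (deriv (deriv f)) (weak_deriv (deriv (deriv f)))"
    using w is_weak_deriv_weak_deriv by blast
  then show "weak_deriv (deriv (deriv f)) \<in> L2_per"
    by (simp add: is_weak_deriv_def)
qed

lemma H3_per_lincomb:
  fixes a b :: real
  assumes "f \<in> H3_per" "g \<in> H3_per"
  defines "h \<equiv> \<lambda>x. a * f x + b * g x"
  shows "h \<in> H3_per"
    "deriv h = (\<lambda>x. a * deriv f x + b * deriv g x)"
    "deriv (deriv h) = (\<lambda>x. a * deriv (deriv f) x + b * deriv (deriv g) x)"
    "AE x in lborel. weak_deriv (deriv (deriv h)) x
       = a * weak_deriv (deriv (deriv f)) x + b * weak_deriv (deriv (deriv g)) x"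
proof -
  have d: "\<And>x. f differentiable (at x)" "\<And>x. deriv f differentiable (at x)"
    "\<And>x. g differentiable (at x)" "\<And>x. deriv g differentiable (at x)"
    using assms by (auto simp: H3_per_def)
  show h1: "deriv h = (\<lambda>x. a * deriv f x + b * deriv g x)"
    unfolding h_def by (rule deriv_lincomb[OF d(1,3)])
  show h2: "deriv (deriv h) = (\<lambda>x. a * deriv (deriv f) x + b * deriv (deriv g) x)"
    unfolding h1 by (rule deriv_lincomb[OF d(2,4)])
  have w: "is_weak_deriv (deriv (deriv h))
    (\<lambda>x. a * weak_deriv (deriv (deriv f)) x + b * weak_deriv (deriv (deriv g)) x)"
    unfolding h2 by (intro is_weak_deriv_lincomb H3_per_L2 assms)
  show h: "h \<in> H3_per"
    unfolding H3_per_def mem_Collect_eq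
  proof (intro conjI allI)
    show "h (x + 2 * pi) = h x" for x
      using assms by (auto simp: H3_per_def)
    show "h differentiable at x" for x
      unfolding h_def using d by auto
    show "deriv h differentiable at x" for x
      unfolding h1 using d by auto
  qed (use w in blast)
  show "AE x in lborel. weak_deriv (deriv (deriv h)) x
       = a * weak_deriv (deriv (deriv f)) x + b * weak_deriv (deriv (deriv g)) x"
    by (rule is_weak_deriv_unique[OF H3_per_L2(5)[OF h] w])
qed

lemma L2_inner_lincomb:
  assumes "f \<in> L2_per" "g \<in> L2_per" "k \<in> L2_per" "h \<in> L2_per"
    and "AE x in lborel. h x = a * f x + b * g x"
  shows "L2_inner h k = a * L2_inner f k + b * L2_inner g k"
proof -
  have [measurable]: "f \<in> borel_measurable borel" "g \<in> borel_measurable borel"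
    "h \<in> borel_measurable borel" "k \<in> borel_measurable borel"
    using assms by (auto simp: L2_per_def)
  have "L2_inner h k = (LBINT x:{0..2*pi}. a * (f x * k x) + b * (g x * k x))"
    unfolding L2_inner_def set_lebesgue_integral_def
  proof (rule integral_cong_AE)
    show "AE x in lborel. indicator {0..2*pi} x *\<^sub>R (h x * k x)
       = indicator {0..2*pi} x *\<^sub>R (a * (f x * k x) + b * (g x * k x))"
      using assms(5) by eventually_elim (auto simp: algebra_simps)
  qed measurable
  also have "\<dots> = a * L2_inner f k + b * L2_inner g k"
    unfolding L2_inner_def
    using L2_set_integrable_mult[OF assms(1,3)] L2_set_integrable_mult[OF assms(2,3)]
    by (subst set_integral_add(2)) auto
  finally show ?thesis .
qed

lemma H3_inner_lincomb:
  assumes "f \<in> H3_per" "g \<in> H3_per" "k \<in> H3_per"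
  shows "H3_inner (\<lambda>x. a * f x + b * g x) k = a * H3_inner f k + b * H3_inner g k"
proof -
  note L = H3_per_lincomb[OF assms(1,2), of a b]
  have 0: "L2_inner (\<lambda>x. a * f x + b * g x) k = a * L2_inner f k + b * L2_inner g k"
    by (rule L2_inner_lincomb) (auto intro: H3_per_L2 assms L(1,4))
  have 1: "L2_inner (deriv (\<lambda>x. a * f x + b * g x)) (deriv k)
      = a * L2_inner (deriv f) (deriv k) + b * L2_inner (deriv g) (deriv k)"
  proof (rule L2_inner_lincomb)
    show "AE x in lborel. deriv (\<lambda>x. a * f x + b * g x) x = a * deriv f x + b * deriv g x"
      by (simp only: L(2)) simp
  qed (auto intro: H3_per_L2 assms L(1))
  have 2: "L2_inner (deriv (deriv (\<lambda>x. a * f x + b * g x))) (deriv (deriv k))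
      = a * L2_inner (deriv (deriv f)) (deriv (deriv k)) + b * L2_inner (deriv (deriv g)) (deriv (deriv k))"
  proof (rule L2_inner_lincomb)
    show "AE x in lborel. deriv (deriv (\<lambda>x. a * f x + b * g x)) x
       = a * deriv (deriv f) x + b * deriv (deriv g) x"
      by (simp only: L(3)) simp
  qed (auto intro: H3_per_L2 assms L(1))
  have 3: "L2_inner (weak_deriv (deriv (deriv (\<lambda>x. a * f x + b * g x)))) (weak_deriv (deriv (deriv k)))
      = a * L2_inner (weak_deriv (deriv (deriv f))) (weak_deriv (deriv (deriv k)))
      + b * L2_inner (weak_deriv (deriv (deriv g))) (weak_deriv (deriv (deriv k)))"
    by (rule L2_inner_lincomb) (auto intro: H3_per_L2 assms L(1,4))
  show ?thesis
    unfolding H3_inner_def 0 1 2 3 by (simp add: algebra_simps)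
qed

lemma L2_inner_commute: "L2_inner f g = L2_inner g f"
  by (simp add: L2_inner_def mult.commute)

lemma L2_inner_ge_0: "0 \<le> L2_inner f f"
  unfolding L2_inner_def set_lebesgue_integral_def
  by (intro integral_nonneg_AE) auto

lemma H3_inner_eq_0:
  assumes f: "f \<in> H3_per" and "H3_inner f f = 0"
  shows "f = (\<lambda>_. 0)"
proof
  have d: "\<And>x. isCont f x" and per: "\<And>x. f (x + 2 * pi) = f x"
    using f by (auto simp: H3_per_def intro: differentiable_imp_continuous_within)
  have c: "continuous_on {0..2*pi} (\<lambda>x. f x * f x)"
    using d by (intro continuous_intros continuous_at_imp_continuous_on) auto
  have "L2_inner f f = 0"
    using assms(2) L2_inner_ge_0[of f] L2_inner_ge_0[of "deriv f"] L2_inner_ge_0[of "deriv (deriv f)"]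
      L2_inner_ge_0[of "weak_deriv (deriv (deriv f))"]
    unfolding H3_inner_def by linarith
  then have "integral {0..2*pi} (\<lambda>x. f x * f x) = 0"
    unfolding L2_inner_def
    using set_borel_integral_eq_integral(2)[OF L2_set_integrable_mult[OF H3_per_L2(1)[OF f] H3_per_L2(1)[OF f]]]
    by simp
  then have "((\<lambda>x. f x * f x) has_integral 0) (cbox 0 (2*pi))"
    using integrable_continuous_real[OF c] by (simp add: has_integral_integral)
  then have z: "f x * f x = 0" if "x \<in> {0..2*pi}" for x
    using has_integral_0_cbox_imp_0[of 0 "2*pi" "\<lambda>x. f x * f x" x] c that pi_gt_zero by (auto simp: not_le)
  fix x
  define n where "n = \<lfloor>x / (2*pi)\<rfloor>"
  have pn: "f (y + real k * (2*pi)) = f y" for y and k :: nat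
  proof (induction k)
    case (Suc k)
    have "f (y + real (Suc k) * (2*pi)) = f ((y + real k * (2*pi)) + 2 * pi)"
      by (simp add: algebra_simps)
    then show ?case using per Suc by simp
  qed simp
  have pi: "f (y + of_int k * (2*pi)) = f y" for y and k :: int
  proof (cases "0 \<le> k")
    case True
    then show ?thesis using pn[of y "nat k"] by simp
  next
    case False
    then show ?thesis using pn[of "y + of_int k * (2*pi)" "nat (-k)"] by simp
  qed
  have "of_int n \<le> x / (2*pi)" "x / (2*pi) < of_int n + 1"
    unfolding n_def by linarith+
  then have "x - of_int n * (2*pi) \<in> {0..2*pi}"
    by (auto simp: field_simps)
  from z[OF this] show "f x = 0"
    using pi[of "x - of_int n * (2*pi)" n] by simp
qed

lemma zero_in_H3_per: "(\<lambda>_. 0) \<in> H3_per"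
proof -
  have "is_weak_deriv (\<lambda>_. 0) (\<lambda>_. 0)"
    by (simp add: is_weak_deriv_def const_in_L2_per set_lebesgue_integral_def)
  moreover have "deriv (\<lambda>_::real. 0::real) = (\<lambda>_. 0)"
    by (auto simp: fun_eq_iff)
  ultimately show ?thesis
    by (auto simp: H3_per_def)
qed

lemma sine_series_lincomb:
  assumes "f \<in> sine_series" "g \<in> sine_series" "f \<in> H3_per" "g \<in> H3_per"
  shows "(\<lambda>x. a * f x + b * g x) \<in> sine_series"
  unfolding sine_series_def mem_Collect_eq
proof
  fix n :: nat
  have c: "(\<lambda>x. cos (real n * x)) \<in> L2_per"
  proof (rule continuous_in_L2_per)
    fix x
    have "cos (real n * (x + 2 * pi)) = cos (real n * x + 2 * real n * pi)"
      by (simp add: algebra_simps)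
    also have "\<dots> = cos (real n * x)"
      by (simp add: cos_add)
    finally show "cos (real n * (x + 2 * pi)) = cos (real n * x)" .
  qed (auto intro!: continuous_intros)
  have "L2_inner (\<lambda>x. a * f x + b * g x) (\<lambda>x. cos (real n * x))
     = a * L2_inner f (\<lambda>x. cos (real n * x)) + b * L2_inner g (\<lambda>x. cos (real n * x))"
    using assms by (intro L2_inner_lincomb c H3_per_L2(1) H3_per_lincomb(1)) auto
  also have "\<dots> = 0"
    using assms by (simp add: sine_series_def L2_inner_def)
  finally show "(LBINT x:{0..2*pi}. (a * f x + b * g x) * cos (real n * x)) = 0"
    by (simp add: L2_inner_def)
qed

section \<open>The Hilbert space of odd functions\<close>

typedef h3_odd = "H3_per \<inter> sine_series"
  morphisms h3_fun Abs_h3_odd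
  using zero_in_H3_per by (auto simp: sine_series_def set_lebesgue_integral_def)

lemma h3_fun_lincomb:
  "h3_fun (Abs_h3_odd (\<lambda>x. a * h3_fun f x + b * h3_fun g x)) = (\<lambda>x. a * h3_fun f x + b * h3_fun g x)"
  using h3_fun[of f] h3_fun[of g]
  by (intro Abs_h3_odd_inverse IntI H3_per_lincomb sine_series_lincomb) auto

instantiation h3_odd :: real_vector
begin

definition zero_h3_odd :: h3_odd where
  "0 = Abs_h3_odd (\<lambda>_. 0)"

definition plus_h3_odd :: "h3_odd \<Rightarrow> h3_odd \<Rightarrow> h3_odd" where
  "f + g = Abs_h3_odd (\<lambda>x. h3_fun f x + h3_fun g x)"

definition minus_h3_odd :: "h3_odd \<Rightarrow> h3_odd \<Rightarrow> h3_odd" where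
  "f - g = Abs_h3_odd (\<lambda>x. h3_fun f x - h3_fun g x)"

definition uminus_h3_odd :: "h3_odd \<Rightarrow> h3_odd" where
  "- f = Abs_h3_odd (\<lambda>x. - h3_fun f x)"

definition scaleR_h3_odd :: "real \<Rightarrow> h3_odd \<Rightarrow> h3_odd" where
  "scaleR c f = Abs_h3_odd (\<lambda>x. c * h3_fun f x)"

lemma h3_fun_zero: "h3_fun 0 = (\<lambda>_. 0)"
  using h3_fun_lincomb[of 0 undefined 0 undefined] by (simp add: zero_h3_odd_def)

lemma h3_fun_plus: "h3_fun (f + g) = (\<lambda>x. h3_fun f x + h3_fun g x)"
  using h3_fun_lincomb[of 1 f 1 g] by (simp add: plus_h3_odd_def)

lemma h3_fun_minus: "h3_fun (f - g) = (\<lambda>x. h3_fun f x - h3_fun g x)"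
  using h3_fun_lincomb[of 1 f "-1" g] by (simp add: minus_h3_odd_def)

lemma h3_fun_uminus: "h3_fun (- f) = (\<lambda>x. - h3_fun f x)"
  using h3_fun_lincomb[of "-1" f 0 f] by (simp add: uminus_h3_odd_def)

lemma h3_fun_scaleR: "h3_fun (c *\<^sub>R f) = (\<lambda>x. c * h3_fun f x)"
  using h3_fun_lincomb[of c f 0 f] by (simp add: scaleR_h3_odd_def)

instance
  by standard (simp_all add: h3_fun_inject[symmetric] h3_fun_zero h3_fun_plus h3_fun_minus
      h3_fun_uminus h3_fun_scaleR algebra_simps)

end

instantiation h3_odd :: real_inner
begin

definition inner_h3_odd :: "h3_odd \<Rightarrow> h3_odd \<Rightarrow> real" where
  "inner f g = H3_inner (h3_fun f) (h3_fun g)"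

definition norm_h3_odd :: "h3_odd \<Rightarrow> real" where
  "norm (f :: h3_odd) = sqrt (inner f f)"

definition sgn_h3_odd :: "h3_odd \<Rightarrow> h3_odd" where
  "sgn (f :: h3_odd) = f /\<^sub>R norm f"

definition dist_h3_odd :: "h3_odd \<Rightarrow> h3_odd \<Rightarrow> real" where
  "dist (f :: h3_odd) g = norm (f - g)"

definition uniformity_h3_odd :: "(h3_odd \<times> h3_odd) filter" where
  "uniformity = (INF e\<in>{0<..}. principal {(f :: h3_odd, g). dist f g < e})"

definition open_h3_odd :: "h3_odd set \<Rightarrow> bool" where
  "open (U :: h3_odd set) \<longleftrightarrow> (\<forall>f\<in>U. eventually (\<lambda>(f', g). f' = f \<longrightarrow> g \<in> U) uniformity)"

instance
proof
  note ops = h3_fun_zero h3_fun_plus h3_fun_minus h3_fun_uminus h3_fun_scaleR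
  fix f g h :: h3_odd and c :: real
  show "sgn f = f /\<^sub>R norm f" "dist f g = norm (f - g)" "norm f = sqrt (inner f f)"
    "uniformity = (INF e\<in>{0<..}. principal {(f::h3_odd, g). dist f g < e})"
    "open (U :: h3_odd set) \<longleftrightarrow> (\<forall>f\<in>U. eventually (\<lambda>(f', g). f' = f \<longrightarrow> g \<in> U) uniformity)" for U :: "h3_odd set"
    by (simp_all only: sgn_h3_odd_def dist_h3_odd_def norm_h3_odd_def uniformity_h3_odd_def open_h3_odd_def)
  have H: "h3_fun k \<in> H3_per" for k using h3_fun[of k] by simp
  show "inner f g = inner g f"
    by (simp add: inner_h3_odd_def H3_inner_def L2_inner_commute)
  show "inner (f + g) h = inner f h + inner g h"
    using H3_inner_lincomb[OF H[of f] H[of g] H[of h], of 1 1] by (simp add: inner_h3_odd_def ops)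
  show sc: "inner (c *\<^sub>R f) g = c * inner f g" for f g :: h3_odd and c
    using H3_inner_lincomb[OF H[of f] H[of f] H[of g], of c 0] by (simp add: inner_h3_odd_def ops)
  show "0 \<le> inner f f"
    by (simp add: inner_h3_odd_def H3_inner_def L2_inner_ge_0)
  show "inner f f = 0 \<longleftrightarrow> f = 0"
  proof
    assume "inner f f = 0"
    then show "f = 0"
      using H3_inner_eq_0[OF H[of f]] by (simp add: inner_h3_odd_def h3_fun_inject[symmetric] ops)
  next
    assume "f = 0"
    then have "f = 0 *\<^sub>R f" by (simp add: h3_fun_inject[symmetric] ops)
    then show "inner f f = 0" using sc[of 0 f f] by simp
  qed
qed

end

section \<open>The flame front model\<close>

text \<open>The argument \<open>\<theta>\<close> is the tangent angle as a function of the normalized arclength \<open>\<sigma>\<close>.\<close>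

definition front_length :: "h3_odd \<Rightarrow> real" where
  "front_length \<theta> = 4 * pi\<^sup>2 / (LBINT \<sigma>:{0..2*pi}. cos (h3_fun \<theta> \<sigma>))"

definition s_\<sigma> :: "h3_odd \<Rightarrow> real" where
  "s_\<sigma> \<theta> = front_length \<theta> / (2 * pi)"

text \<open>The formula for the length is meaningful only for such \<open>\<theta>\<close>.\<close>

definition admissible :: "h3_odd \<Rightarrow> bool" where
  "admissible \<theta> \<longleftrightarrow> 0 < (LBINT \<sigma>:{0..2*pi}. cos (h3_fun \<theta> \<sigma>))"

definition curvature :: "h3_odd \<Rightarrow> real \<Rightarrow> real" where
  "curvature \<theta> \<sigma> = deriv (h3_fun \<theta>) \<sigma> / s_\<sigma> \<theta>"

text \<open>
  With \<open>d/ds = (1/s\<^sub>\<sigma>) d/d\<sigma>\<close>; the second derivative of the curvature involves the third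
  derivative of \<open>\<theta>\<close> and exists only weakly, hence is determined almost everywhere.
\<close>

definition curvature_s :: "h3_odd \<Rightarrow> real \<Rightarrow> real" where
  "curvature_s \<theta> \<sigma> = deriv (curvature \<theta>) \<sigma> / s_\<sigma> \<theta>"

definition curvature_ss :: "h3_odd \<Rightarrow> real \<Rightarrow> real" where
  "curvature_ss \<theta> \<sigma> = weak_deriv (curvature_s \<theta>) \<sigma> / s_\<sigma> \<theta>"

definition normal_velocity :: "real \<Rightarrow> h3_odd \<Rightarrow> real \<Rightarrow> real" where
  "normal_velocity \<alpha> \<theta> \<sigma> =
     - (1 + (\<alpha> - 1) * curvature \<theta> \<sigma> + \<alpha>\<^sup>2 * (\<alpha> + 3) * curvature_ss \<theta> \<sigma>
        + (1 + \<alpha> / 2) * (curvature \<theta> \<sigma>)\<^sup>2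
        + (2 * \<alpha> + 5 * \<alpha>\<^sup>2 - \<alpha> ^ 3 / 3) * (curvature \<theta> \<sigma>) ^ 3)"

text \<open>
  The equations of motion \<open>(x, y)\<^sub>t = U n + V \<tau>\<close> with unit normal \<open>n = (-sin \<theta>, cos \<theta>)\<close>
  and unit tangent \<open>\<tau> = (cos \<theta>, sin \<theta>)\<close>: here \<open>\<Theta> t\<close> is the
  tangent angle at time \<open>t\<close>, \<open>U\<close> the normal velocity prescribed by the model, and \<open>V \<sigma> t\<close> the tangential velocity.
\<close>

definition flame_front :: "real \<Rightarrow> (real \<Rightarrow> h3_odd) \<Rightarrow> (real \<Rightarrow> real \<Rightarrow> real) \<Rightarrow>
    (real \<Rightarrow> real \<Rightarrow> real) \<Rightarrow> (real \<Rightarrow> real \<Rightarrow> real) \<Rightarrow> bool" where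
  "flame_front \<alpha> \<Theta> V x y \<longleftrightarrow>
     (\<forall>t. admissible (\<Theta> t)) \<and>
     (\<forall>\<sigma> t. x (\<sigma> + 2 * pi) t = x \<sigma> t + 2 * pi \<and> y (\<sigma> + 2 * pi) t = y \<sigma> t) \<and>
     (\<forall>\<sigma> t. ((\<lambda>\<sigma>. x \<sigma> t) has_real_derivative s_\<sigma> (\<Theta> t) * cos (h3_fun (\<Theta> t) \<sigma>)) (at \<sigma>) \<and>
            ((\<lambda>\<sigma>. y \<sigma> t) has_real_derivative s_\<sigma> (\<Theta> t) * sin (h3_fun (\<Theta> t) \<sigma>)) (at \<sigma>)) \<and>
     (\<forall>t. AE \<sigma> in lborel.
        ((\<lambda>t. x \<sigma> t) has_real_derivative
           normal_velocity \<alpha> (\<Theta> t) \<sigma> * (- sin (h3_fun (\<Theta> t) \<sigma>)) + V \<sigma> t * cos (h3_fun (\<Theta> t) \<sigma>)) (at t) \<and>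
        ((\<lambda>t. y \<sigma> t) has_real_derivative
           normal_velocity \<alpha> (\<Theta> t) \<sigma> * cos (h3_fun (\<Theta> t) \<sigma>) + V \<sigma> t * sin (h3_fun (\<Theta> t) \<sigma>)) (at t))"

definition vertically_traveling :: "h3_odd \<Rightarrow> real \<Rightarrow> real \<Rightarrow> bool" where
  "vertically_traveling \<theta> \<beta> \<alpha> \<longleftrightarrow> (\<exists>V x y.
     flame_front \<alpha> (\<lambda>_. \<theta>) V x y \<and>
     (\<forall>\<sigma> t. ((\<lambda>t. x \<sigma> t) has_real_derivative 0) (at t) \<and>
            ((\<lambda>t. y \<sigma> t) has_real_derivative - \<beta>) (at t)) \<and>
     (AE \<sigma> in lborel. normal_velocity \<alpha> \<theta> \<sigma> = - \<beta> * cos (h3_fun \<theta> \<sigma>)) \<and>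
     (\<forall>\<sigma> t. V \<sigma> t = - \<beta> * sin (h3_fun \<theta> \<sigma>)))"

definition flame_F :: "h3_odd \<Rightarrow> real \<Rightarrow> real \<Rightarrow> real \<Rightarrow> real" where
  "flame_F \<theta> \<beta> \<alpha> \<sigma> =
     1 + (\<alpha> - 1) * (deriv (h3_fun \<theta>) \<sigma> / s_\<sigma> \<theta>)
       + (1 + \<alpha> / 2) * ((deriv (h3_fun \<theta>) \<sigma>)\<^sup>2 / (s_\<sigma> \<theta>)\<^sup>2)
       + (2 * \<alpha> + 5 * \<alpha>\<^sup>2 - \<alpha> ^ 3 / 3) * ((deriv (h3_fun \<theta>) \<sigma>) ^ 3 / (s_\<sigma> \<theta>) ^ 3)
       + \<alpha>\<^sup>2 * (\<alpha> + 3) * (weak_deriv (deriv (deriv (h3_fun \<theta>))) \<sigma> / (s_\<sigma> \<theta>) ^ 3)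
       - \<beta> * cos (h3_fun \<theta> \<sigma>)"

text \<open>Equality in \<open>L\<^sup>2\<close> is equality almost everywhere.\<close>

definition flame_F_zero :: "h3_odd \<times> real \<times> real \<Rightarrow> bool" where
  "flame_F_zero = (\<lambda>(\<theta>, \<beta>, \<alpha>). admissible \<theta> \<and> (AE \<sigma> in lborel. flame_F \<theta> \<beta> \<alpha> \<sigma> = 0))"

definition trivial_solutions :: "(h3_odd \<times> real \<times> real) set" where
  "trivial_solutions = {(0, 1, \<alpha>) | \<alpha>. True}"

definition flame_q :: "nat \<Rightarrow> real poly" where
  "flame_q k\<^sub>0 = [:-1, 1:] - [:0, 1:]\<^sup>2 * [:3, 1:] * [:(real k\<^sub>0)\<^sup>2:]"

end

(* Crandall-Rabinowitz bifurcation by hand. At (0, 1, \<alpha>\<^sub>0) the linearisation of F is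
   D\<^sub>0 (u''' + k\<^sup>2 u') - b, with kernel spanned by sin (k \<sigma>) and range orthogonal to cos (k \<sigma>).
   Put \<theta> = \<omega> u, \<beta> = 1 + \<omega> b and divide F by \<omega>. With w = u''' as the unknown,
   u''' + k\<^sup>2 u' is inverted by variation of constants, the constant \<beta> absorbs the mean of the
   remainder, and q'(\<alpha>\<^sub>0) \<noteq> 0 lets \<alpha> absorb its component along cos (k \<sigma>). This gives a fixed point
   equation for (w, \<alpha> - \<alpha>\<^sub>0, b) whose derivative in these unknowns vanishes at \<omega> = 0. Everything takes place
   in bounded continuous functions, because solutions are classical; oddness and periodicity
   are built in by reflecting functions on [0, \<pi>], so that no Fourier series are needed. *)
theory Submission
  imports Defs
begin

section \<open>Continuously differentiable maps between normed spaces\<close>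

text \<open>During the iteration the two solvability conditions fail, so every operator must make
  sense for an arbitrary bounded continuous function. Primitives are therefore kept on [0, pi] only;
  their reflections stay bounded but may have kinks at multiples of pi. At a fixed point the two
  means vanish, and the reflections turn out to be smooth periodic functions;
  \<open>step_fixed_point\<close> and \<open>step_fixed_point_solution\<close> mostly carry out this
  identification. No unknown ever stands in a denominator: 1 / s_sigma is the mean of cos \<theta>,
  and F is polynomial in it. All maps are then C1 on whole spaces, as \<open>C1_map\<close> demands,
  and positivity of the length integral is checked only afterwards, for small \<omega>. The
  contraction runs in the bounded continuous functions because they are complete;
  \<open>h3_odd\<close> enters only as the target of a bounded linear map. The normalisation u'(0) =
  1 fixes the amplitude and forces \<theta> to be nonzero for \<omega> \<noteq> 0.\<close>

definition C1_map :: "('a::real_normed_vector \<Rightarrow> 'b::real_normed_vector) \<Rightarrow> bool" where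
  "C1_map f \<longleftrightarrow> (\<exists>f' :: 'a \<Rightarrow> 'a \<Rightarrow>\<^sub>L 'b.
     (\<forall>x. (f has_derivative blinfun_apply (f' x)) (at x)) \<and> continuous_on UNIV f')"

lemma C1_mapI:
  assumes "\<And>x. (f has_derivative blinfun_apply (f' x)) (at x)" "continuous_on UNIV f'"
  shows "C1_map f"
  using assms unfolding C1_map_def by blast

lemma C1_mapE:
  assumes "C1_map f"
  obtains f' where "\<And>x. (f has_derivative blinfun_apply (f' x)) (at x)" "continuous_on UNIV f'"
  using assms unfolding C1_map_def by blast

lemma C1_map_continuous_on:
  assumes "C1_map f"
  shows "continuous_on UNIV f"
proof -
  obtain f' where "\<And>x. (f has_derivative blinfun_apply (f' x)) (at x)"
    using C1_mapE[OF assms] by blast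
  then show ?thesis
    by (intro continuous_at_imp_continuous_on ballI) (rule has_derivative_continuous)
qed

lemma C1_map_const: "C1_map (\<lambda>_. c)"
  by (rule C1_mapI[of _ "\<lambda>_. 0"]) (auto simp: zero_blinfun.rep_eq)

lemma bounded_linear_imp_C1_map:
  assumes "bounded_linear f"
  shows "C1_map f"
  by (rule C1_mapI[of _ "\<lambda>_. Blinfun f"])
    (auto simp: bounded_linear_Blinfun_apply assms bounded_linear_imp_has_derivative)

lemma C1_map_compose:
  assumes "C1_map g" "C1_map f"
  shows "C1_map (\<lambda>x. g (f x))"
proof -
  obtain g' where g': "\<And>x. (g has_derivative blinfun_apply (g' x)) (at x)" "continuous_on UNIV g'"
    using C1_mapE[OF assms(1)] by blast
  obtain f' where f': "\<And>x. (f has_derivative blinfun_apply (f' x)) (at x)" "continuous_on UNIV f'"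
    using C1_mapE[OF assms(2)] by blast
  show ?thesis
  proof (rule C1_mapI)
    show "((\<lambda>x. g (f x)) has_derivative blinfun_apply (g' (f x) o\<^sub>L f' x)) (at x)" for x
      using has_derivative_compose[OF f'(1) g'(1)] by (simp add: o_def blinfun_compose.rep_eq)
    have "continuous_on UNIV (\<lambda>x. g' (f x))"
      using continuous_on_compose2[OF g'(2) C1_map_continuous_on[OF assms(2)]] by auto
    then show "continuous_on UNIV (\<lambda>x. g' (f x) o\<^sub>L f' x)"
      using f'(2) by (intro bounded_bilinear.continuous_on[OF bounded_bilinear_blinfun_compose])
  qed
qed

lemma C1_map_linear_compose:
  assumes "bounded_linear L" "C1_map f"
  shows "C1_map (\<lambda>x. L (f x))"
  by (rule C1_map_compose[OF bounded_linear_imp_C1_map[OF assms(1)] assms(2)])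

lemma C1_map_add:
  assumes "C1_map f" "C1_map g"
  shows "C1_map (\<lambda>x. f x + g x)"
proof -
  obtain f' where f': "\<And>x. (f has_derivative blinfun_apply (f' x)) (at x)" "continuous_on UNIV f'"
    using C1_mapE[OF assms(1)] by blast
  obtain g' where g': "\<And>x. (g has_derivative blinfun_apply (g' x)) (at x)" "continuous_on UNIV g'"
    using C1_mapE[OF assms(2)] by blast
  show ?thesis
    by (rule C1_mapI[of _ "\<lambda>x. f' x + g' x"])
      (auto simp: plus_blinfun.rep_eq intro!: has_derivative_add f' g' continuous_on_add)
qed

lemma (in bounded_bilinear) C1_map:
  assumes "C1_map f" "C1_map g"
  shows "C1_map (\<lambda>x. prod (f x) (g x))"
proof -
  obtain f' where f': "\<And>x. (f has_derivative blinfun_apply (f' x)) (at x)" "continuous_on UNIV f'"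
    using C1_mapE[OF assms(1)] by blast
  obtain g' where g': "\<And>x. (g has_derivative blinfun_apply (g' x)) (at x)" "continuous_on UNIV g'"
    using C1_mapE[OF assms(2)] by blast
  show ?thesis
  proof (rule C1_mapI)
    show "((\<lambda>x. prod (f x) (g x)) has_derivative
        blinfun_apply ((prod_right (f x) o\<^sub>L g' x) + (prod_left (g x) o\<^sub>L f' x))) (at x)" for x
      using FDERIV[OF f'(1) g'(1)]
      by (simp add: plus_blinfun.rep_eq prod_right.rep_eq prod_left.rep_eq fun_eq_iff blinfun_compose.rep_eq o_def)
    show "continuous_on UNIV (\<lambda>x. (prod_right (f x) o\<^sub>L g' x) + (prod_left (g x) o\<^sub>L f' x))"
      by (intro continuous_on_add bounded_bilinear.continuous_on[OF bounded_bilinear_blinfun_compose]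
          bounded_linear.continuous_on[OF bounded_linear_prod_right]
          bounded_linear.continuous_on[OF bounded_linear_prod_left] f' g' C1_map_continuous_on assms)
  qed
qed

lemmas C1_map_scaleR = bounded_bilinear.C1_map[OF bounded_bilinear_scaleR]
lemmas C1_map_mult = bounded_bilinear.C1_map[OF bounded_bilinear_mult]

lemma C1_map_diff:
  assumes "C1_map f" "C1_map g"
  shows "C1_map (\<lambda>x. f x - g x)"
  using C1_map_add[OF assms(1) C1_map_linear_compose[OF bounded_linear_minus[OF bounded_linear_ident] assms(2)]]
  by simp

lemma C1_map_power:
  fixes f :: "'a::real_normed_vector \<Rightarrow> real"
  assumes "C1_map f"
  shows "C1_map (\<lambda>x. f x ^ n)"
  by (induction n) (simp_all add: C1_map_const C1_map_mult assms)

lemma C1_map_Pair: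
  assumes "C1_map f" "C1_map g"
  shows "C1_map (\<lambda>x. (f x, g x))"
proof -
  have "C1_map (\<lambda>x. (f x, 0) + (0, g x))"
    by (intro C1_map_add C1_map_linear_compose[of "\<lambda>y. (y, 0)"] C1_map_linear_compose[of "\<lambda>y. (0, y)"]
        bounded_linear_Pair bounded_linear_ident bounded_linear_zero assms)
  then show ?thesis by simp
qed

text \<open>Carries the curve of fixed points into the H^3 norm, and gives continuity of
  \<open>inv_s\<close> along it.\<close>

lemma C1_map_imp_C1_differentiable_on:
  assumes f: "C1_map f" and c: "c C1_differentiable_on S"
  shows "(\<lambda>t. f (c t)) C1_differentiable_on S"
proof -
  obtain f' where f': "\<And>x. (f has_derivative blinfun_apply (f' x)) (at x)" "continuous_on UNIV f'"
    using C1_mapE[OF f] by blast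
  obtain D where D: "\<And>t. t \<in> S \<Longrightarrow> (c has_vector_derivative D t) (at t)" "continuous_on S D"
    using c unfolding C1_differentiable_on_def by blast
  have deriv: "((\<lambda>t. f (c t)) has_vector_derivative f' (c t) (D t)) (at t)" if "t \<in> S" for t
    using vector_derivative_diff_chain_within[OF has_vector_derivative_at_within[OF D(1)[OF that]],
        of f "f' (c t)" UNIV] has_derivative_at_withinI[OF f'(1)]
    by (simp add: o_def)
  have "continuous_on S c"
    using D(1) by (meson continuous_at_imp_continuous_on has_vector_derivative_continuous)
  then have "continuous_on S (\<lambda>t. f' (c t))"
    by (rule continuous_on_compose2[OF f'(2)]) auto
  then have "continuous_on S (\<lambda>t. f' (c t) (D t))"
    using D(2) by (rule bounded_bilinear.continuous_on[OF bounded_bilinear_blinfun_apply])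
  with deriv show ?thesis
    unfolding C1_differentiable_on_def by (intro exI[of _ "\<lambda>t. f' (c t) (D t)"]) simp
qed

text \<open>Uniform contraction principle: by continuity of the derivative, F (\<omega>, _) is a
  1/2-contraction near \<open>x0\<close>. Its fixed point is Lipschitz in \<omega>, and the
  derivative of the fixed point is itself the fixed point of the linearised equation.
  \<open>deriv0\<close> is directional so that it can be checked along lines.\<close>

theorem C1_map_fixed_point_curve:
  fixes F :: "real \<times> 'a::banach \<Rightarrow> 'a"
  assumes F: "C1_map F" and x0: "F (0, x0) = x0"
    and deriv0: "\<And>h. ((\<lambda>t. F (0, x0 + t *\<^sub>R h)) has_vector_derivative 0) (at 0)"
  obtains \<delta> x where "\<delta> > 0" "x 0 = x0" "\<And>\<omega>. \<bar>\<omega>\<bar> < \<delta> \<Longrightarrow> F (\<omega>, x \<omega>) = x \<omega>"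
    "x C1_differentiable_on {-\<delta><..<\<delta>}"
proof -
  obtain F' where F': "\<And>p. (F has_derivative blinfun_apply (F' p)) (at p)" "continuous_on UNIV F'"
    using C1_mapE[OF F] by blast
  have zero: "F' (0, x0) (0, h) = 0" for h
  proof -
    have "((\<lambda>t. (0, x0 + t *\<^sub>R h)) has_vector_derivative (0, h)) (at (0::real))"
      unfolding has_vector_derivative_def by (auto intro!: derivative_eq_intros)
    then have "((F \<circ> (\<lambda>t. (0, x0 + t *\<^sub>R h))) has_vector_derivative F' (0, x0) (0, h)) (at 0)"
      using vector_derivative_diff_chain_within[of "\<lambda>t. (0, x0 + t *\<^sub>R h)" _ 0 UNIV F "F' (0, x0)"]
        has_derivative_at_withinI[OF F'(1)] by simp
    then show ?thesis
      using vector_derivative_unique_at[OF _ deriv0] by (auto simp: o_def)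
  qed
  have "isCont F' (0, x0)"
    using F'(2) by (simp add: continuous_on_eq_continuous_at)
  then obtain r0 where "r0 > 0" and r0: "\<And>p. dist p (0, x0) < r0 \<Longrightarrow> dist (F' p) (F' (0, x0)) < 1/2"
    unfolding continuous_at_eps_delta by (metis half_gt_zero_iff zero_less_one)
  \<comment> \<open>A third leaves room for |\<omega>| + dist x x0 \<le> 2 * r < r0.\<close>
  define r where "r = r0 / 3"
  have "r > 0" using \<open>r0 > 0\<close> by (simp add: r_def)
  define M where "M = norm (F' (0, x0)) + 1/2"
  have "M > 0" by (simp add: M_def add_nonneg_pos)
  have near: "norm (F' (\<omega>, x) - F' (0, x0)) < 1/2" if "\<bar>\<omega>\<bar> \<le> r" "x \<in> cball x0 r" for \<omega> x
  proof -
    have "dist (\<omega>, x) (0, x0) \<le> dist \<omega> 0 + dist x x0"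
      unfolding dist_Pair_Pair using sqrt_sum_squares_le_sum[of "dist \<omega> 0" "dist x x0"] by simp
    also have "\<dots> < r0" using that \<open>r0 > 0\<close> by (simp add: r_def dist_commute)
    finally show ?thesis using r0 by (simp add: dist_norm)
  qed
  have M: "norm (F' (\<omega>, x)) \<le> M" if "\<bar>\<omega>\<bar> \<le> r" "x \<in> cball x0 r" for \<omega> x
    using near[OF that] norm_triangle_sub[of "F' (\<omega>, x)" "F' (0, x0)"] unfolding M_def by linarith
  have half: "norm (F' (\<omega>, x) (0, h)) \<le> 1/2 * norm h" if "\<bar>\<omega>\<bar> \<le> r" "x \<in> cball x0 r" for \<omega> x h
  proof -
    have "norm (F' (\<omega>, x) (0, h)) = norm ((F' (\<omega>, x) - F' (0, x0)) (0, h))"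
      by (simp add: zero minus_blinfun.rep_eq)
    also have "\<dots> \<le> norm (F' (\<omega>, x) - F' (0, x0)) * norm (0::real, h)"
      by (rule norm_blinfun)
    also have "\<dots> \<le> 1/2 * norm h"
      using near[OF that] by (intro mult_mono) (auto simp: norm_Pair)
    finally show ?thesis .
  qed
  have contr: "norm (F (\<omega>, x) - F (\<omega>, y)) \<le> 1/2 * norm (x - y)"
    if "\<bar>\<omega>\<bar> \<le> r" "x \<in> cball x0 r" "y \<in> cball x0 r" for \<omega> x y
  proof (rule differentiable_bound[OF convex_cball])
    show "((\<lambda>x. F (\<omega>, x)) has_derivative (\<lambda>h. F' (\<omega>, z) (0, h))) (at z within cball x0 r)" for z
      by (rule has_derivative_compose[OF _ F'(1)]) (auto intro!: derivative_eq_intros)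
    show "onorm (\<lambda>h. F' (\<omega>, z) (0, h)) \<le> 1/2" if "z \<in> cball x0 r" for z
      by (rule onorm_bound) (use half[OF \<open>\<bar>\<omega>\<bar> \<le> r\<close> that] in auto)
  qed (use that in auto)
  have Lip1: "norm (F (\<omega>, x) - F (\<omega>', x)) \<le> M * norm (\<omega> - \<omega>')"
    if "\<bar>\<omega>\<bar> \<le> r" "\<bar>\<omega>'\<bar> \<le> r" "x \<in> cball x0 r" for \<omega> \<omega>' x
  proof (rule differentiable_bound[of "cball 0 r"])
    show "((\<lambda>\<omega>. F (\<omega>, x)) has_derivative (\<lambda>h. F' (z, x) (h, 0))) (at z within cball 0 r)" for z
      by (rule has_derivative_compose[OF _ F'(1)]) (auto intro!: derivative_eq_intros)
    show "onorm (\<lambda>h. F' (z, x) (h, 0)) \<le> M" if "z \<in> cball 0 r" for z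
    proof (rule onorm_bound)
      show "0 \<le> M" using \<open>M > 0\<close> by simp
      fix h :: real
      have "norm (F' (z, x) (h, 0)) \<le> norm (F' (z, x)) * norm (h, 0::'a)"
        by (rule norm_blinfun)
      also have "\<dots> \<le> M * norm h"
        using M[OF _ \<open>x \<in> cball x0 r\<close>, of z] that \<open>M > 0\<close> by (intro mult_mono) (auto simp: norm_Pair)
      finally show "norm (F' (z, x) (h, 0)) \<le> M * norm h" .
    qed
  qed (use that in auto)
  \<comment> \<open>The second bound makes the shift M * |\<omega>| at most r / 2; the contraction
    uses the other half of the radius, so the ball is mapped into itself.\<close>
  define \<delta> where "\<delta> = min r (r / (2 * M + 1))"
  have "\<delta> > 0" "\<delta> \<le> r" using \<open>r > 0\<close> \<open>M > 0\<close> by (auto simp: \<delta>_def)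
  have \<delta>M: "M * \<bar>\<omega>\<bar> \<le> r/2" if "\<bar>\<omega>\<bar> < \<delta>" for \<omega>
  proof -
    have "\<bar>\<omega>\<bar> \<le> r / (2 * M + 1)" using that by (simp add: \<delta>_def)
    then have "\<bar>\<omega>\<bar> * (2 * M + 1) \<le> r" using \<open>M > 0\<close> by (simp add: field_simps)
    then show ?thesis by (simp add: algebra_simps) 
  qed
  have ex: "\<exists>!x \<in> cball x0 r. F (\<omega>, x) = x" if "\<bar>\<omega>\<bar> < \<delta>" for \<omega>
  proof (rule Banach_fix[where c="1/2"])
    show "complete (cball x0 r)" by (simp add: complete_eq_closed)
    have le: "\<bar>\<omega>\<bar> \<le> r" using that \<open>\<delta> \<le> r\<close> by simp
    show "(\<lambda>x. F (\<omega>, x)) ` cball x0 r \<subseteq> cball x0 r"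
    proof (rule image_subsetI)
      fix x assume x: "x \<in> cball x0 r"
      have "norm (F (\<omega>, x) - x0) \<le> norm (F (\<omega>, x) - F (\<omega>, x0)) + norm (F (\<omega>, x0) - F (0, x0))"
        using norm_triangle_ineq[of "F (\<omega>, x) - F (\<omega>, x0)" "F (\<omega>, x0) - F (0, x0)"] x0 by simp
      also have "\<dots> \<le> 1/2 * norm (x - x0) + M * \<bar>\<omega>\<bar>"
        using contr[OF le x, of x0] Lip1[OF le, of 0 x0] \<open>r > 0\<close> by simp
      also have "\<dots> \<le> r" using \<delta>M[OF that] x by (simp add: dist_norm norm_minus_commute)
      finally show "F (\<omega>, x) \<in> cball x0 r" by (simp add: dist_norm norm_minus_commute)
    qed
  qed (use contr[of \<omega>] that \<open>\<delta> \<le> r\<close> \<open>r > 0\<close> in \<open>auto simp: dist_norm\<close>)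
  define x where "x \<omega> = (THE x. x \<in> cball x0 r \<and> F (\<omega>, x) = x)" for \<omega>
  have x: "x \<omega> \<in> cball x0 r" "F (\<omega>, x \<omega>) = x \<omega>" if "\<bar>\<omega>\<bar> < \<delta>" for \<omega>
    using theI'[OF ex[OF that, unfolded Ex1_def Bex_def, folded Ex1_def]] unfolding x_def by auto
  have "x 0 = x0"
  proof -
    have "\<bar>0::real\<bar> < \<delta>" "x0 \<in> cball x0 r" using \<open>r > 0\<close> \<open>\<delta> > 0\<close> by simp_all
    then show ?thesis using ex[of 0] x[of 0] x0 by blast
  qed
  have Lip: "norm (x \<omega> - x \<omega>') \<le> 2 * M * \<bar>\<omega> - \<omega>'\<bar>" if "\<bar>\<omega>\<bar> < \<delta>" "\<bar>\<omega>'\<bar> < \<delta>" for \<omega> \<omega>'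
  proof -
    have le: "\<bar>\<omega>\<bar> \<le> r" "\<bar>\<omega>'\<bar> \<le> r" using that \<open>\<delta> \<le> r\<close> by auto
    have "norm (x \<omega> - x \<omega>') = norm ((F (\<omega>, x \<omega>) - F (\<omega>, x \<omega>')) + (F (\<omega>, x \<omega>') - F (\<omega>', x \<omega>')))"
      using x that by simp
    also have "\<dots> \<le> 1/2 * norm (x \<omega> - x \<omega>') + M * \<bar>\<omega> - \<omega>'\<bar>"
      using norm_triangle_ineq[of "F (\<omega>, x \<omega>) - F (\<omega>, x \<omega>')" "F (\<omega>, x \<omega>') - F (\<omega>', x \<omega>')"]
        contr[OF le(1) x(1)[OF that(1)] x(1)[OF that(2)]] Lip1[OF le x(1)[OF that(2)]]
      unfolding real_norm_def by simp
    finally show ?thesis by simp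
  qed
  \<comment> \<open>Differentiating F (\<omega>, x \<omega>) = x \<omega> formally gives this
    equation for the derivative; it is a 1/2-contraction in y.\<close>
  define y where "y \<omega> = (THE y. F' (\<omega>, x \<omega>) (1, y) = y)" for \<omega>
  have split: "F' p (t, u) - F' p (t, v) = F' p (0, u - v)" for p t u v
    by (simp flip: blinfun.diff_right)
  have y: "F' (\<omega>, x \<omega>) (1, y \<omega>) = y \<omega>" if "\<bar>\<omega>\<bar> < \<delta>" for \<omega>
  proof -
    have "\<exists>!y. F' (\<omega>, x \<omega>) (1, y) = y"
      using half[OF _ x(1)[OF that]] that \<open>\<delta> \<le> r\<close>
      by (intro banach_fix_type[of "1/2"]) (auto simp: dist_norm split)
    then show ?thesis unfolding y_def by (rule theI')
  qed
  have xcont: "isCont x \<omega>" if "\<bar>\<omega>\<bar> < \<delta>" for \<omega>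
  proof -
    have "((\<lambda>t. x t - x \<omega>) \<longlongrightarrow> 0) (at \<omega>)"
    proof (rule Lim_null_comparison)
      have "\<forall>\<^sub>F t in at \<omega>. t \<in> {-\<delta><..<\<delta>}"
        using that by (intro eventually_at_in_open') auto
      then show "\<forall>\<^sub>F t in at \<omega>. norm (x t - x \<omega>) \<le> 2 * M * \<bar>t - \<omega>\<bar>"
        by eventually_elim (use that in \<open>auto intro!: Lip\<close>)
      show "((\<lambda>t. 2 * M * \<bar>t - \<omega>\<bar>) \<longlongrightarrow> 0) (at \<omega>)"
        by (auto intro!: tendsto_eq_intros)
    qed
    then show ?thesis by (simp add: isCont_def LIM_zero_iff)
  qed
  have deriv: "(x has_vector_derivative y \<omega>) (at \<omega>)" if \<omega>: "\<bar>\<omega>\<bar> < \<delta>" for \<omega>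
    unfolding has_vector_derivative_def has_derivative_at_alt
  proof (intro conjI allI impI bounded_linear_scaleR_left)
    fix e :: real assume "e > 0"
    \<comment> \<open>1 + 2 * M is the Lipschitz constant of the curve (t, x t); the factor 2 pays
      for the half of norm z that is absorbed at the end.\<close>
    define e' where "e' = e / (2 * (1 + 2 * M))"
    have "e' > 0" using \<open>e > 0\<close> \<open>M > 0\<close> by (simp add: e'_def)
    obtain d where "d > 0" and d: "\<And>p. norm (p - (\<omega>, x \<omega>)) < d \<Longrightarrow>
        norm (F p - F (\<omega>, x \<omega>) - F' (\<omega>, x \<omega>) (p - (\<omega>, x \<omega>))) \<le> e' * norm (p - (\<omega>, x \<omega>))"
      using F'(1)[of "(\<omega>, x \<omega>)"] \<open>e' > 0\<close> unfolding has_derivative_at_alt by blast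
    define d' where "d' = min (\<delta> - \<bar>\<omega>\<bar>) (d / (1 + 2 * M))"
    have "d' > 0" using \<omega> \<open>d > 0\<close> \<open>M > 0\<close> by (simp add: d'_def)
    show "\<exists>d>0. \<forall>t. norm (t - \<omega>) < d \<longrightarrow> norm (x t - x \<omega> - (t - \<omega>) *\<^sub>R y \<omega>) \<le> e * norm (t - \<omega>)"
    proof (intro exI[of _ d'] conjI allI impI \<open>d' > 0\<close>)
      fix t assume t: "norm (t - \<omega>) < d'"
      then have t\<delta>: "\<bar>t\<bar> < \<delta>" unfolding d'_def real_norm_def by linarith
      define z where "z = x t - x \<omega> - (t - \<omega>) *\<^sub>R y \<omega>"
      have "norm ((t, x t) - (\<omega>, x \<omega>)) \<le> \<bar>t - \<omega>\<bar> + norm (x t - x \<omega>)"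
        using norm_Pair_le[of "t - \<omega>" "x t - x \<omega>"] by simp
      also have "\<dots> \<le> (1 + 2 * M) * \<bar>t - \<omega>\<bar>"
        using Lip[OF t\<delta> \<omega>] by (simp add: algebra_simps)
      finally have n: "norm ((t, x t) - (\<omega>, x \<omega>)) \<le> (1 + 2 * M) * \<bar>t - \<omega>\<bar>" .
      have "(1 + 2 * M) * \<bar>t - \<omega>\<bar> < d"
        using t \<open>M > 0\<close> by (simp add: d'_def field_simps)
      then have "norm (F (t, x t) - F (\<omega>, x \<omega>) - F' (\<omega>, x \<omega>) ((t, x t) - (\<omega>, x \<omega>)))
          \<le> e' * norm ((t, x t) - (\<omega>, x \<omega>))"
        using n by (intro d) simp
      also have "\<dots> \<le> e' * ((1 + 2 * M) * \<bar>t - \<omega>\<bar>)"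
        using n \<open>e' > 0\<close> by (intro mult_left_mono) auto
      also have "\<dots> = e / 2 * \<bar>t - \<omega>\<bar>"
        using \<open>M > 0\<close> by (simp add: e'_def field_simps)
      finally have *: "norm (x t - x \<omega> - F' (\<omega>, x \<omega>) (t - \<omega>, x t - x \<omega>)) \<le> e / 2 * \<bar>t - \<omega>\<bar>"
        using x t\<delta> \<omega> by simp
      have "F' (\<omega>, x \<omega>) (t - \<omega>, x t - x \<omega>)
          = F' (\<omega>, x \<omega>) ((t - \<omega>) *\<^sub>R (1, y \<omega>) + (0, z))"
        by (simp add: z_def)
      also have "\<dots> = (t - \<omega>) *\<^sub>R y \<omega> + F' (\<omega>, x \<omega>) (0, z)"
        unfolding blinfun.add_right blinfun.scaleR_right y[OF \<omega>] ..
      finally have eq: "F' (\<omega>, x \<omega>) (t - \<omega>, x t - x \<omega>) = (t - \<omega>) *\<^sub>R y \<omega> + F' (\<omega>, x \<omega>) (0, z)" .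
      have "x t - x \<omega> - F' (\<omega>, x \<omega>) (t - \<omega>, x t - x \<omega>) = z - F' (\<omega>, x \<omega>) (0, z)"
        unfolding eq z_def by (rule diff_diff_eq[symmetric])
      with * have "norm (z - F' (\<omega>, x \<omega>) (0, z)) \<le> e / 2 * \<bar>t - \<omega>\<bar>"
        by simp
      moreover have "norm z \<le> norm (z - F' (\<omega>, x \<omega>) (0, z)) + norm (F' (\<omega>, x \<omega>) (0, z))"
        using norm_triangle_ineq[of "z - F' (\<omega>, x \<omega>) (0, z)" "F' (\<omega>, x \<omega>) (0, z)"] by simp
      moreover have "norm (F' (\<omega>, x \<omega>) (0, z)) \<le> 1/2 * norm z"
        using half[OF _ x(1)[OF \<omega>]] \<omega> \<open>\<delta> \<le> r\<close> by simp
      ultimately show "norm (x t - x \<omega> - (t - \<omega>) *\<^sub>R y \<omega>) \<le> e * norm (t - \<omega>)"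
        unfolding z_def[symmetric] by simp
    qed
  qed
  have ycont: "isCont y \<omega>" if \<omega>: "\<bar>\<omega>\<bar> < \<delta>" for \<omega>
  proof -
    have "((\<lambda>t. y t - y \<omega>) \<longlongrightarrow> 0) (at \<omega>)"
    proof (rule Lim_null_comparison)
      have "\<forall>\<^sub>F t in at \<omega>. t \<in> {-\<delta><..<\<delta>}"
        using that by (intro eventually_at_in_open') auto
      then show "\<forall>\<^sub>F t in at \<omega>. norm (y t - y \<omega>)
          \<le> 2 * (norm (F' (t, x t) - F' (\<omega>, x \<omega>)) * norm (1::real, y \<omega>))"
      proof eventually_elim
        case (elim t)
        then have t: "\<bar>t\<bar> < \<delta>" by auto
        \<comment> \<open>Difference of the two linear fixed point equations: the contraction
          absorbs the first summand, and the second tends to 0 with F'.\<close>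
        have "y t - y \<omega> = F' (t, x t) (0, y t - y \<omega>) + (F' (t, x t) - F' (\<omega>, x \<omega>)) (1, y \<omega>)"
          using y[OF t] y[OF \<omega>] split[of "(t, x t)" 1 "y t" "y \<omega>"]
          by (simp add: minus_blinfun.rep_eq algebra_simps)
        then have "norm (y t - y \<omega>) \<le> norm (F' (t, x t) (0, y t - y \<omega>))
            + norm ((F' (t, x t) - F' (\<omega>, x \<omega>)) (1, y \<omega>))"
          by (metis norm_triangle_ineq)
        moreover have "norm (F' (t, x t) (0, y t - y \<omega>)) \<le> 1/2 * norm (y t - y \<omega>)"
          using half[OF _ x(1)[OF t]] t \<open>\<delta> \<le> r\<close> by simp
        moreover have "norm ((F' (t, x t) - F' (\<omega>, x \<omega>)) (1, y \<omega>))
            \<le> norm (F' (t, x t) - F' (\<omega>, x \<omega>)) * norm (1::real, y \<omega>)"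
          by (rule norm_blinfun)
        ultimately show ?case by linarith
      qed
      have "isCont (\<lambda>t. (t, x t)) \<omega>"
        by (intro continuous_intros xcont[OF \<omega>])
      moreover have "isCont F' (\<omega>, x \<omega>)"
        using F'(2) by (simp add: continuous_on_eq_continuous_at)
      ultimately have "isCont (\<lambda>t. F' (t, x t)) \<omega>"
        by (rule isCont_o2)
      then have "((\<lambda>t. F' (t, x t) - F' (\<omega>, x \<omega>)) \<longlongrightarrow> 0) (at \<omega>)"
        by (simp add: isCont_def LIM_zero_iff)
      then show "((\<lambda>t. 2 * (norm (F' (t, x t) - F' (\<omega>, x \<omega>)) * norm (1::real, y \<omega>))) \<longlongrightarrow> 0) (at \<omega>)"
        by (intro tendsto_mult_right_zero tendsto_mult_left_zero tendsto_norm_zero)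
    qed
    then show ?thesis by (simp add: isCont_def LIM_zero_iff)
  qed
  show thesis
  proof (rule that[OF \<open>\<delta> > 0\<close> \<open>x 0 = x0\<close> x(2)])
    show "x C1_differentiable_on {-\<delta><..<\<delta>}"
      unfolding C1_differentiable_on_def
    proof (intro exI[of _ y] conjI ballI continuous_at_imp_continuous_on)
      fix \<omega> :: real assume "\<omega> \<in> {-\<delta><..<\<delta>}"
      then have "\<bar>\<omega>\<bar> < \<delta>" by auto
      then show "(x has_vector_derivative y \<omega>) (at \<omega>)" "isCont y \<omega>"
        by (fact deriv, fact ycont)
    qed
  qed
qed

section \<open>Primitives of even and odd periodic functions\<close>

text \<open>An antiderivative on the whole line, normalised at 0, so that parity arguments need no
  case split on the sign of x.\<close>

definition prim :: "(real \<Rightarrow> real) \<Rightarrow> real \<Rightarrow> real" where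
  "prim f = (SOME F. F 0 = 0 \<and> (\<forall>x. (F has_real_derivative f x) (at x)))"

lemma
  assumes "continuous_on UNIV f"
  shows prim_0: "prim f 0 = 0" and has_real_derivative_prim: "(prim f has_real_derivative f x) (at x)"
proof -
  have "\<And>x. isCont f x" using assms by (simp add: continuous_on_eq_continuous_at)
  then obtain F where F: "\<And>x. (F has_real_derivative f x) (at x)"
    using einterval_antiderivative[of "-\<infinity>" \<infinity> f] by (auto simp: has_real_derivative_iff_has_vector_derivative)
  have "\<exists>F. F 0 = 0 \<and> (\<forall>x. (F has_real_derivative f x) (at x))"
    by (intro exI[of _ "\<lambda>x. F x - F 0"]) (auto intro!: derivative_eq_intros F)
  then have "prim f 0 = 0 \<and> (\<forall>x. (prim f has_real_derivative f x) (at x))"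
    unfolding prim_def by (rule someI_ex)
  then show "prim f 0 = 0" "(prim f has_real_derivative f x) (at x)" by auto
qed

lemma continuous_on_prim:
  assumes "continuous_on UNIV f"
  shows "continuous_on A (prim f)"
  using has_real_derivative_prim[OF assms] DERIV_isCont by (blast intro: continuous_at_imp_continuous_on)

lemma abs_prim_le:
  assumes "continuous_on UNIV f" "0 \<le> x" "\<And>y. y \<in> {0..x} \<Longrightarrow> \<bar>f y\<bar> \<le> B"
  shows "\<bar>prim f x\<bar> \<le> B * x"
proof -
  have "norm (prim f x - prim f 0) \<le> B * norm (x - 0)"
  proof (rule field_differentiable_bound[of "{0..x}"])
    show "(prim f has_field_derivative f y) (at y within {0..x})" for y
      by (rule DERIV_subset[OF has_real_derivative_prim[OF assms(1)]]) simp
  qed (use assms in auto)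
  then show ?thesis using assms(2) by (simp add: prim_0[OF assms(1)])
qed

lemma prim_eqI:
  assumes "continuous_on UNIV f" "F 0 = 0" "\<And>x. (F has_real_derivative f x) (at x)"
  shows "prim f x = F x"
proof -
  have "((\<lambda>x. prim f x - F x) has_real_derivative 0) (at x)" for x
    using DERIV_diff[OF has_real_derivative_prim[OF assms(1)] assms(3)] by simp
  then have "prim f x - F x = prim f 0 - F 0"
    by (rule DERIV_isconst_all[rule_format]) 
  then show ?thesis using assms by (simp add: prim_0)
qed

text \<open>Lets reflected integrands be replaced by the smooth functions with which they coincide
  on [0, pi].\<close>

lemma prim_cong:
  assumes "continuous_on UNIV f" "continuous_on UNIV g" "0 \<le> x" "\<And>y. y \<in> {0..x} \<Longrightarrow> f y = g y"
  shows "prim f x = prim g x"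
proof -
  have "prim (\<lambda>y. f y - g y) x = prim f x - prim g x"
    by (rule prim_eqI) (use assms in \<open>auto intro!: continuous_intros derivative_eq_intros
      has_real_derivative_prim simp: prim_0\<close>)
  moreover have "\<bar>prim (\<lambda>y. f y - g y) x\<bar> \<le> 0 * x"
    by (rule abs_prim_le) (use assms in \<open>auto intro!: continuous_intros\<close>)
  ultimately show ?thesis by simp
qed

lemma prim_lincomb:
  assumes "continuous_on UNIV f" "continuous_on UNIV g"
  shows "prim (\<lambda>x. a * f x + b * g x) x = a * prim f x + b * prim g x"
  by (rule prim_eqI)
    (use assms in \<open>auto intro!: continuous_intros derivative_eq_intros has_real_derivative_prim simp: prim_0\<close>)

lemma prim_diff_const:
  assumes "continuous_on UNIV f"
  shows "prim (\<lambda>x. f x - c) x = prim f x - c * x"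
  by (rule prim_eqI)
    (use assms in \<open>auto intro!: continuous_intros derivative_eq_intros has_real_derivative_prim simp: prim_0\<close>)

lemma LBINT_eq_prim:
  assumes "continuous_on UNIV f" "0 \<le> a"
  shows "(LBINT x:{0..a}. f x) = prim f a"
  unfolding set_lebesgue_integral_def
  by (subst integral_FTC_atLeastAtMost[of 0 a "prim f"])
    (use assms in \<open>auto simp: prim_0 has_real_derivative_iff_has_vector_derivative[symmetric]
      intro: DERIV_subset[OF has_real_derivative_prim] continuous_on_subset\<close>)

section \<open>Parity and periodicity of primitives\<close>

definition even_per :: "(real \<Rightarrow> real) \<Rightarrow> bool" where
  "even_per f \<longleftrightarrow> (\<forall>x. f (- x) = f x) \<and> (\<forall>x. f (x + 2 * pi) = f x)"

definition odd_per :: "(real \<Rightarrow> real) \<Rightarrow> bool" where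
  "odd_per f \<longleftrightarrow> (\<forall>x. f (- x) = - f x) \<and> (\<forall>x. f (x + 2 * pi) = f x)"

lemma odd_per_pi: "odd_per f \<Longrightarrow> f pi = 0"
proof -
  assume "odd_per f"
  then have "f (- pi + 2 * pi) = f (- pi)" "f (- pi) = - f pi" unfolding odd_per_def by blast+
  moreover have "- pi + 2 * pi = pi" by simp
  ultimately show "f pi = 0" by simp
qed

lemma prim_minus:
  assumes "continuous_on UNIV f" "\<And>x. f (- x) = s * f x"
  shows "prim f (- x) = - s * prim f x"
proof -
  have "prim (\<lambda>x. s * f x) x = - prim f (- x)"
  proof (rule prim_eqI)
    show "((\<lambda>x. - prim f (- x)) has_real_derivative s * f x) (at x)" for x
      using assms(2) has_real_derivative_prim[OF assms(1), of "- x"]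
      by (auto intro!: derivative_eq_intros DERIV_chain2[of "prim f"])
  qed (use assms in \<open>auto simp: prim_0 intro!: continuous_intros\<close>)
  moreover have "prim (\<lambda>x. s * f x) x = s * prim f x"
    using prim_lincomb[OF assms(1,1), of s 0] by simp
  ultimately show ?thesis by simp
qed

lemma prim_periodic:
  assumes "continuous_on UNIV f" "\<And>x. f (x + 2 * pi) = f x" "prim f (- pi) = prim f pi"
  shows "prim f (x + 2 * pi) = prim f x"
proof -
  \<comment> \<open>The shifted primitive, renormalised at 0, is again a primitive of f; at - pi
    this shows that the increment over a period is 0.\<close>
  have *: "prim f x = prim f (x + 2 * pi) - prim f (2 * pi)" for x
  proof (rule prim_eqI)
    show "((\<lambda>x. prim f (x + 2 * pi) - prim f (2 * pi)) has_real_derivative f x) (at x)" for x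
      using DERIV_diff[OF iffD1[OF DERIV_shift has_real_derivative_prim[OF assms(1), of "x + 2 * pi"]]
          DERIV_const[of "prim f (2 * pi)"]] assms(2) by simp
  qed (use assms(1) in simp_all)
  have "prim f (2 * pi) = 0" using *[of "- pi"] assms(3) by simp
  then show ?thesis using *[of x] by simp
qed

text \<open>The condition at pi is what makes the odd primitive periodic: it then vanishes at both -
  pi and pi.\<close>

lemma odd_per_prim:
  assumes "continuous_on UNIV f" "even_per f" "prim f pi = 0"
  shows "odd_per (prim f)"
  using prim_minus[OF assms(1), of 1] assms prim_periodic[OF assms(1)]
  by (auto simp: even_per_def odd_per_def)

lemma even_per_prim:
  assumes "continuous_on UNIV f" "odd_per f"
  shows "even_per (prim f)"
  using prim_minus[OF assms(1), of "-1"] assms prim_periodic[OF assms(1)]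
  by (auto simp: even_per_def odd_per_def)

lemma prim_two_pi_odd:
  assumes "continuous_on UNIV f" "odd_per f"
  shows "prim f (2 * pi) = 0"
  using even_per_prim[OF assms] prim_0[OF assms(1)] unfolding even_per_def
  by (metis add_0)

lemma prim_two_pi_even:
  assumes "continuous_on UNIV f" "even_per f"
  shows "prim f (2 * pi) = 2 * prim f pi"
proof -
  \<comment> \<open>Without its mean the function has a periodic primitive, so the integral over the
    period comes from the linear term c * x alone.\<close>
  define c where "c = prim f pi / pi"
  have "odd_per (prim (\<lambda>x. f x - c))"
  proof (rule odd_per_prim)
    show "prim (\<lambda>x. f x - c) pi = 0"
      by (simp add: prim_diff_const[OF assms(1)] c_def)
  qed (use assms in \<open>auto simp: even_per_def intro!: continuous_intros\<close>)
  then have "prim (\<lambda>x. f x - c) (2 * pi) = prim (\<lambda>x. f x - c) 0"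
    unfolding odd_per_def by (metis add_0)
  then show ?thesis
    by (simp add: prim_diff_const[OF assms(1)] c_def prim_0[OF assms(1)])
qed

section \<open>Even reflection through the triangle wave\<close>

definition tri :: "real \<Rightarrow> real" where
  "tri x = arccos (cos x)"

lemma tri_bounds: "0 \<le> tri x" "tri x \<le> pi"
  by (simp_all add: tri_def arccos_lbound arccos_ubound)

lemma tri_id: "0 \<le> x \<Longrightarrow> x \<le> pi \<Longrightarrow> tri x = x"
  by (simp add: tri_def arccos_cos)

lemma continuous_on_tri: "continuous_on A tri"
  unfolding tri_def by (intro continuous_intros) auto

lemma even_per_compose_tri: "even_per (\<lambda>x. f (tri x))"
  by (simp add: even_per_def tri_def)

text \<open>\<open>tri\<close> is the distance to the nearest multiple of 2 * pi: shift x into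
  [- pi, pi], where it is the absolute value.\<close>

lemma even_per_tri:
  assumes "even_per f"
  shows "f (tri x) = f x"
proof -
  interpret f: periodic_fun_simple f "2 * pi"
    by unfold_locales (use assms in \<open>simp add: even_per_def\<close>)
  interpret tri: periodic_fun_simple tri "2 * pi"
    by unfold_locales (simp add: tri_def)
  define n where "n = \<lfloor>(x + pi) / (2 * pi)\<rfloor>"
  define y where "y = x - of_int n * (2 * pi)"
  have "of_int n \<le> (x + pi) / (2 * pi)" "(x + pi) / (2 * pi) < of_int n + 1"
    unfolding n_def by linarith+
  then have y: "- pi \<le> y" "y \<le> pi"
    by (auto simp: y_def field_simps)
  have "tri y = \<bar>y\<bar>"
    using y tri_id[of "\<bar>y\<bar>"] by (auto simp: tri_def abs_if split: if_splits)
  moreover have "f y = f \<bar>y\<bar>"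
    using assms by (simp add: even_per_def abs_if)
  ultimately show ?thesis
    using f.minus_of_int[of x n] tri.minus_of_int[of x n] by (simp add: y_def)
qed

lemma even_per_eqI:
  assumes "even_per f" "even_per g" "\<And>x. 0 \<le> x \<Longrightarrow> x \<le> pi \<Longrightarrow> f x = g x"
  shows "f x = g x"
  using assms(3)[OF tri_bounds, of x] by (simp add: even_per_tri assms)

section \<open>Operators on bounded continuous functions\<close>

lemma bcontfun_real_I:
  fixes f :: "real \<Rightarrow> real"
  assumes "continuous_on UNIV f" "\<And>x. \<bar>f x\<bar> \<le> B"
  shows "f \<in> bcontfun"
  using assms unfolding bcontfun_def bounded_iff by auto

lemma abs_apply_bcontfun_le: "\<bar>apply_bcontfun f x\<bar> \<le> norm f" for f :: "real \<Rightarrow>\<^sub>C real"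
  using norm_bounded[of f x] by simp

instance bcontfun :: (metric_space, banach) banach ..

definition bc_mult :: "(real \<Rightarrow>\<^sub>C real) \<Rightarrow> (real \<Rightarrow>\<^sub>C real) \<Rightarrow> real \<Rightarrow>\<^sub>C real" where
  "bc_mult f g = Bcontfun (\<lambda>x. f x * g x)"

lemma bc_mult_apply [simp]: "bc_mult f g x = f x * g x"
proof -
  have "(\<lambda>x. f x * g x) \<in> bcontfun"
    by (rule bcontfun_real_I[of _ "norm f * norm g"])
      (auto simp: abs_mult intro!: continuous_intros mult_mono abs_apply_bcontfun_le)
  then show ?thesis by (simp add: bc_mult_def Bcontfun_inverse)
qed

lemma bounded_bilinear_bc_mult: "bounded_bilinear bc_mult"
proof (unfold_locales)
  show "\<exists>K. \<forall>a b. norm (bc_mult a b) \<le> norm a * norm b * K"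
    by (rule exI[of _ 1]) (auto intro!: norm_bound mult_mono abs_apply_bcontfun_le simp: abs_mult)
qed (auto intro!: bcontfun_eqI simp: algebra_simps)

definition bc_compose :: "(real \<Rightarrow> real) \<Rightarrow> (real \<Rightarrow>\<^sub>C real) \<Rightarrow> real \<Rightarrow>\<^sub>C real" where
  "bc_compose h f = Bcontfun (\<lambda>x. h (f x))"

lemma bc_compose_apply:
  assumes "continuous_on UNIV h" "\<And>x. \<bar>h x\<bar> \<le> B"
  shows "bc_compose h f x = h (f x)"
proof -
  have "(\<lambda>x. h (f x)) \<in> bcontfun"
    by (rule bcontfun_real_I[of _ B]) (use assms continuous_on_compose2[of UNIV h UNIV "apply_bcontfun f"] in auto)
  then show ?thesis by (simp add: bc_compose_def Bcontfun_inverse)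
qed

text \<open>The derivative at f is multiplication by h' composed with f. The Lipschitz bound on h'
  makes the Taylor remainder quadratic uniformly in the point, as the sup norm requires.\<close>

lemma C1_map_bc_compose:
  assumes deriv: "\<And>x. (h has_real_derivative h' x) (at x)"
    and Lip: "\<And>x y. \<bar>h' x - h' y\<bar> \<le> \<bar>x - y\<bar>"
    and bounds: "\<And>x. \<bar>h x\<bar> \<le> B" "\<And>x. \<bar>h' x\<bar> \<le> B'"
  shows "C1_map (bc_compose h)"
proof -
  interpret bounded_bilinear bc_mult by (rule bounded_bilinear_bc_mult)
  have h: "continuous_on UNIV h"
    using deriv by (meson DERIV_isCont continuous_at_imp_continuous_on)
  have h': "continuous_on UNIV h'"
    unfolding continuous_on_iff dist_real_def using Lip by (meson le_less_trans)
  note app = bc_compose_apply[OF h bounds(1)] bc_compose_apply[OF h' bounds(2)]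
  have taylor: "\<bar>h b - h a - h' a * (b - a)\<bar> \<le> \<bar>b - a\<bar> * \<bar>b - a\<bar>" for a b
  proof -
    have "norm ((h b - h' a * b) - (h a - h' a * a)) \<le> \<bar>b - a\<bar> * norm (b - a)"
    proof (rule field_differentiable_bound[of "closed_segment a b"])
      fix z assume z: "z \<in> closed_segment a b"
      show "((\<lambda>z. h z - h' a * z) has_real_derivative (h' z - h' a)) (at z within closed_segment a b)"
        by (rule DERIV_subset[of _ _ _ UNIV]) (auto intro!: derivative_eq_intros deriv)
      have "\<bar>h' z - h' a\<bar> \<le> \<bar>z - a\<bar>" by (rule Lip)
      also have "\<dots> \<le> \<bar>b - a\<bar>" using z by (auto simp: closed_segment_eq_real_ivl split: if_splits)
      finally show "norm (h' z - h' a) \<le> \<bar>b - a\<bar>" by simp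
    qed auto
    then show ?thesis by (simp add: algebra_simps)
  qed
  show ?thesis
  proof (rule C1_mapI)
    show "(bc_compose h has_derivative blinfun_apply (prod_right (bc_compose h' f))) (at f)" for f
      unfolding has_derivative_at_alt
    proof (intro conjI allI impI blinfun.bounded_linear_right)
      fix e :: real assume "e > 0"
      \<comment> \<open>The remainder is at most the square of norm (g - f), so e itself serves as
        the radius.\<close>
      have "norm (bc_compose h g - bc_compose h f - bc_mult (bc_compose h' f) (g - f)) \<le> e * norm (g - f)"
        if "norm (g - f) < e" for g
      proof (rule norm_bound)
        fix x
        have gf: "\<bar>g x - f x\<bar> \<le> norm (g - f)" using abs_apply_bcontfun_le[of "g - f" x] by simp
        have "\<bar>h (g x) - h (f x) - h' (f x) * (g x - f x)\<bar> \<le> \<bar>g x - f x\<bar> * \<bar>g x - f x\<bar>" by (rule taylor)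
        also have "\<dots> \<le> e * norm (g - f)" using gf that by (intro mult_mono) auto
        finally show "norm (apply_bcontfun (bc_compose h g - bc_compose h f - bc_mult (bc_compose h' f) (g - f)) x)
            \<le> e * norm (g - f)"
          by (simp add: app)
      qed
      then show "\<exists>d>0. \<forall>g. norm (g - f) < d \<longrightarrow>
          norm (bc_compose h g - bc_compose h f - blinfun_apply (prod_right (bc_compose h' f)) (g - f)) \<le> e * norm (g - f)"
        using \<open>e > 0\<close> by (intro exI[of _ e]) (simp add: prod_right.rep_eq)
    qed
    have "norm (bc_compose h' f - bc_compose h' g) \<le> norm (f - g)" for f g
    proof (rule norm_bound)
      fix x
      show "norm (apply_bcontfun (bc_compose h' f - bc_compose h' g) x) \<le> norm (f - g)"
        using Lip[of "f x" "g x"] abs_apply_bcontfun_le[of "f - g" x] by (simp add: app)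
    qed
    then have "continuous_on UNIV (bc_compose h')"
      unfolding continuous_on_iff dist_norm by (meson le_less_trans)
    then show "continuous_on UNIV (\<lambda>f. prod_right (bc_compose h' f))"
      by (rule bounded_linear.continuous_on[OF bounded_linear_prod_right])
  qed
qed

lemma abs_sin_diff_le: "\<bar>sin x - sin y\<bar> \<le> \<bar>x - y\<bar>" for x y :: real
  using field_differentiable_bound[of UNIV sin cos 1 x y] by (auto intro: DERIV_sin)

lemma abs_cos_diff_le: "\<bar>cos x - cos y\<bar> \<le> \<bar>x - y\<bar>" for x y :: real
  using field_differentiable_bound[of UNIV cos "\<lambda>x. - sin x" 1 x y] by (auto intro: DERIV_cos)

lemma C1_map_bc_sin: "C1_map (bc_compose sin)"
  by (rule C1_map_bc_compose[of _ cos 1 1]) (auto intro: DERIV_sin abs_cos_diff_le)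

lemma C1_map_bc_cos: "C1_map (bc_compose cos)"
proof (rule C1_map_bc_compose[of _ "\<lambda>x. - sin x" 1 1])
  show "\<bar>- sin x - - sin y\<bar> \<le> \<bar>x - y\<bar>" for x y :: real
    using abs_sin_diff_le[of y x] by simp
qed (auto intro: DERIV_cos)

lemma bc_compose_sin_cos [simp]:
  "bc_compose sin f x = sin (f x)" "bc_compose cos f x = cos (f x)"
  by (rule bc_compose_apply[of _ 1]; auto intro: continuous_intros)+

section \<open>Reflected primitives as bounded operators\<close>

definition bc_fold :: "(real \<Rightarrow> real) \<Rightarrow> real \<Rightarrow>\<^sub>C real" where
  "bc_fold h = Bcontfun (\<lambda>x. h (tri x))"

lemma bc_fold_apply:
  assumes "continuous_on UNIV h"
  shows "bc_fold h x = h (tri x)"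
proof -
  have "bounded (h ` {0..pi})"
    using assms by (intro compact_imp_bounded compact_continuous_image) (auto intro: continuous_on_subset)
  then obtain B where "\<forall>y \<in> h ` {0..pi}. \<bar>y\<bar> \<le> B"
    unfolding bounded_iff real_norm_def by blast
  then have "\<bar>h x\<bar> \<le> B" if "x \<in> {0..pi}" for x
    using that by blast
  then have "(\<lambda>x. h (tri x)) \<in> bcontfun"
    using tri_bounds continuous_on_compose2[OF assms continuous_on_tri]
    by (intro bcontfun_real_I[of _ B]) auto
  then show ?thesis by (simp add: bc_fold_def Bcontfun_inverse)
qed

text \<open>Folding keeps the primitive bounded whatever the mean of f. For odd periodic f this is
  the true primitive; for even f it is correct on [0, pi], the only place where a further
  \<open>bc_prim\<close> or \<open>mean\<close> reads it.\<close>

definition bc_prim :: "(real \<Rightarrow>\<^sub>C real) \<Rightarrow> real \<Rightarrow>\<^sub>C real" where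
  "bc_prim f = bc_fold (prim f)"

lemma bc_prim_apply: "bc_prim f x = prim f (tri x)"
  unfolding bc_prim_def by (intro bc_fold_apply continuous_on_prim) simp

lemma prim_bcontfun_lincomb: "prim (apply_bcontfun (a *\<^sub>R f + b *\<^sub>R g)) x = a * prim f x + b * prim g x"
  using prim_lincomb[of "apply_bcontfun f" "apply_bcontfun g" a b x]
  by (simp add: plus_bcontfun.rep_eq[abs_def] scaleR_bcontfun.rep_eq[abs_def])

lemma abs_prim_bcontfun_le: "0 \<le> x \<Longrightarrow> \<bar>prim (apply_bcontfun f) x\<bar> \<le> norm f * x"
  by (rule abs_prim_le) (auto intro: abs_apply_bcontfun_le)

lemma bounded_linear_prim: 
  assumes "0 \<le> x"
  shows "bounded_linear (\<lambda>f. prim (apply_bcontfun f) x)"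
proof (rule bounded_linear_intro[where K=x])
  show "prim (apply_bcontfun (f + g)) x = prim f x + prim g x" for f g :: "real \<Rightarrow>\<^sub>C real"
    using prim_bcontfun_lincomb[of 1 f 1 g x] by simp
  show "prim (apply_bcontfun (r *\<^sub>R f)) x = r *\<^sub>R prim f x" for r and f :: "real \<Rightarrow>\<^sub>C real"
    using prim_bcontfun_lincomb[of r f 0 f x] by simp
qed (use assms in \<open>auto intro: abs_prim_bcontfun_le\<close>)

lemma bounded_linear_bc_prim: "bounded_linear bc_prim"
proof (rule bounded_linear_intro[where K=pi])
  note lin = bounded_linear.linear[OF bounded_linear_prim[OF tri_bounds(1)]]
  have "bc_prim (f + g) x = bc_prim f x + bc_prim g x" for f g x
    unfolding bc_prim_apply by (rule linear_add[OF lin])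
  then show "bc_prim (f + g) = bc_prim f + bc_prim g" for f g
    by (intro bcontfun_eqI) simp
  have "bc_prim (r *\<^sub>R f) x = r *\<^sub>R bc_prim f x" for r f x
    unfolding bc_prim_apply by (rule linear_scale[OF lin])
  then show "bc_prim (r *\<^sub>R f) = r *\<^sub>R bc_prim f" for r f
    by (intro bcontfun_eqI) simp
  show "norm (bc_prim f) \<le> norm f * pi" for f
  proof (rule norm_bound)
    fix x
    have "\<bar>prim (apply_bcontfun f) (tri x)\<bar> \<le> norm f * tri x"
      by (rule abs_prim_bcontfun_le[OF tri_bounds(1)])
    also have "\<dots> \<le> norm f * pi" by (intro mult_left_mono tri_bounds) simp
    finally show "norm (apply_bcontfun (bc_prim f) x) \<le> norm f * pi" by (simp add: bc_prim_apply)
  qed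
qed

section \<open>The third primitive as an operator into the space of odd functions\<close>

lemma
  assumes per: "\<And>x. f0 (x + 2 * pi) = f0 x" "\<And>x. f3 (x + 2 * pi) = f3 x"
    and der: "\<And>x. (f0 has_real_derivative f1 x) (at x)" "\<And>x. (f1 has_real_derivative f2 x) (at x)"
      "\<And>x. (f2 has_real_derivative f3 x) (at x)"
    and cont: "continuous_on UNIV f3"
  shows H3_per_derivI: "f0 \<in> H3_per" and deriv_H3_per_derivI: "deriv f0 = f1" "deriv f1 = f2"
    and weak_deriv_H3_per_derivI: "is_weak_deriv f2 f3"
proof -
  show d: "deriv f0 = f1" "deriv f1 = f2"
    using der by (auto intro!: DERIV_imp_deriv)
  show w: "is_weak_deriv f2 f3"
    unfolding is_weak_deriv_def
  proof (intro conjI allI impI)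
    show "f3 \<in> L2_per"
      using cont per(2) by (intro continuous_in_L2_per) (simp_all add: continuous_on_eq_continuous_at)
    fix a b :: real assume "a \<le> b"
    then show "f2 b - f2 a = (LBINT x:{a..b}. f3 x)"
      unfolding set_lebesgue_integral_def
      by (subst integral_FTC_atLeastAtMost[of a b f2])
        (auto simp: has_real_derivative_iff_has_vector_derivative[symmetric]
          intro: DERIV_subset[OF der(3)] continuous_on_subset[OF cont])
  qed
  show "f0 \<in> H3_per"
    unfolding H3_per_def mem_Collect_eq d using per(1) der(1,2) w real_differentiable_def by blast
qed

lemma odd_per_imp_sine_series:
  assumes "odd_per f" "continuous_on UNIV f"
  shows "f \<in> sine_series"
  unfolding sine_series_def mem_Collect_eq
proof
  fix n :: nat
  have "cos (real n * (x + 2 * pi)) = cos (real n * x)" for x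
  proof -
    have "real n * (x + 2 * pi) = real n * x + 2 * real n * pi" by (simp add: algebra_simps)
    then show ?thesis by (simp only: cos_add) simp
  qed
  then have "odd_per (\<lambda>x. f x * cos (real n * x))"
    using assms(1) by (simp add: odd_per_def)
  moreover have "continuous_on UNIV (\<lambda>x. f x * cos (real n * x))"
    by (intro continuous_intros assms)
  ultimately show "(LBINT x:{0..2*pi}. f x * cos (real n * x)) = 0"
    by (simp add: LBINT_eq_prim prim_two_pi_odd)
qed

text \<open>The average is over [0, pi]; for an even periodic function it equals the average over a
  full period.\<close>

definition zero_mean :: "(real \<Rightarrow> real) \<Rightarrow> real \<Rightarrow> real" where
  "zero_mean h x = h x - prim h pi / pi"

lemma continuous_on_zero_mean: "continuous_on A h \<Longrightarrow> continuous_on A (zero_mean h)"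
  unfolding zero_mean_def by (intro continuous_intros)

lemma even_per_zero_mean: "even_per h \<Longrightarrow> even_per (zero_mean h)"
  by (simp add: even_per_def zero_mean_def)

lemma prim_zero_mean: "continuous_on UNIV h \<Longrightarrow> prim (zero_mean h) pi = 0"
  unfolding zero_mean_def by (simp add: prim_diff_const)

lemma zero_mean_lincomb:
  assumes "continuous_on UNIV f" "continuous_on UNIV g"
  shows "zero_mean (\<lambda>x. a * f x + b * g x) = (\<lambda>x. a * zero_mean f x + b * zero_mean g x)"
  by (rule ext) (simp add: zero_mean_def prim_lincomb assms field_simps)

lemma has_real_derivative_zero_mean:
  "(h has_real_derivative d) (at x) \<Longrightarrow> (zero_mean h has_real_derivative d) (at x)"
  unfolding zero_mean_def[abs_def] by (auto intro!: derivative_eq_intros)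

lemma abs_zero_mean_le:
  assumes "continuous_on UNIV h" "\<And>y. y \<in> {0..2 * pi} \<Longrightarrow> \<bar>h y\<bar> \<le> B" "x \<in> {0..2 * pi}"
  shows "\<bar>zero_mean h x\<bar> \<le> 2 * B"
proof -
  have "\<bar>prim h pi\<bar> \<le> B * pi"
    using assms by (intro abs_prim_le) auto
  then have "\<bar>prim h pi / pi\<bar> \<le> B" by (simp add: abs_div_pos[symmetric] pos_divide_le_eq)
  then show ?thesis using assms(2)[OF assms(3)] unfolding zero_mean_def by linarith
qed

lemma abs_prim_le_two_pi:
  assumes "continuous_on UNIV h" "\<And>y. y \<in> {0..2 * pi} \<Longrightarrow> \<bar>h y\<bar> \<le> B" "x \<in> {0..2 * pi}"
  shows "\<bar>prim h x\<bar> \<le> 2 * pi * B"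
proof -
  have "0 \<le> B" using assms(2)[OF assms(3)] by linarith
  have "\<bar>prim h x\<bar> \<le> B * x" using assms by (intro abs_prim_le) auto
  also have "\<dots> \<le> B * (2 * pi)" using assms(3) \<open>0 \<le> B\<close> by (intro mult_left_mono) auto
  finally show ?thesis by (simp add: mult.commute)
qed

lemma L2_inner_self_le:
  assumes "continuous_on UNIV h" "\<And>y. y \<in> {0..2 * pi} \<Longrightarrow> \<bar>h y\<bar> \<le> B"
  shows "L2_inner h h \<le> 2 * pi * B\<^sup>2"
proof -
  have "\<bar>h y * h y\<bar> \<le> B\<^sup>2" if "y \<in> {0..2 * pi}" for y
    using assms(2)[OF that] mult_mono[of "\<bar>h y\<bar>" B "\<bar>h y\<bar>" B] by (simp add: abs_mult power2_eq_square)
  then have "\<bar>prim (\<lambda>x. h x * h x) (2 * pi)\<bar> \<le> 2 * pi * B\<^sup>2"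
    by (intro abs_prim_le_two_pi) (auto intro!: continuous_intros assms(1))
  then show ?thesis
    unfolding L2_inner_def using assms(1) by (subst LBINT_eq_prim) (auto intro!: continuous_intros)
qed

text \<open>Successive primitives alternate in parity, and only those of even functions need a
  vanishing mean to stay periodic; hence a \<open>zero_mean\<close> before the first and the third
  integration. Folding f first makes the map total.\<close>

definition h3_prim_fun :: "(real \<Rightarrow>\<^sub>C real) \<Rightarrow> real \<Rightarrow> real" where
  "h3_prim_fun f = prim (zero_mean (prim (prim (zero_mean (\<lambda>x. f (tri x))))))"

definition h3_prim :: "(real \<Rightarrow>\<^sub>C real) \<Rightarrow> h3_odd" where
  "h3_prim f = Abs_h3_odd (h3_prim_fun f)"

lemma continuous_on_bcontfun_tri: "continuous_on A (\<lambda>x. apply_bcontfun f (tri x))"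
  using continuous_on_compose2[of UNIV "apply_bcontfun f" A tri] continuous_on_tri by auto

lemma h3_prim_fun_chain:
  fixes f :: "real \<Rightarrow>\<^sub>C real"
  defines "f3 \<equiv> zero_mean (\<lambda>x. f (tri x))"
  defines "f2 \<equiv> prim f3"
  defines "f1 \<equiv> zero_mean (prim f2)"
  shows "continuous_on UNIV f3" "continuous_on UNIV f2" "continuous_on UNIV f1"
    "continuous_on UNIV (h3_prim_fun f)"
    "even_per f3" "odd_per f2" "even_per f1" "odd_per (h3_prim_fun f)"
    "(f2 has_real_derivative f3 x) (at x)" "(f1 has_real_derivative f2 x) (at x)"
    "(h3_prim_fun f has_real_derivative f1 x) (at x)"
proof -
  have c3: "continuous_on A f3" for A
    unfolding f3_def by (intro continuous_on_zero_mean continuous_on_bcontfun_tri)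
  have c2: "continuous_on A f2" for A
    unfolding f2_def by (intro continuous_on_prim c3)
  have c1: "continuous_on A f1" for A
    unfolding f1_def by (intro continuous_on_zero_mean continuous_on_prim c2)
  have f0: "h3_prim_fun f = prim f1"
    by (simp only: h3_prim_fun_def f1_def f2_def f3_def)
  show "continuous_on UNIV f3" "continuous_on UNIV f2" "continuous_on UNIV f1"
    "continuous_on UNIV (h3_prim_fun f)"
    unfolding f0 by (intro c1 c2 c3 continuous_on_prim)+
  show e3: "even_per f3"
    unfolding f3_def by (intro even_per_zero_mean even_per_compose_tri)
  show o2: "odd_per f2"
    unfolding f2_def by (intro odd_per_prim c3 e3) (auto simp: f3_def prim_zero_mean continuous_on_bcontfun_tri)
  show e1: "even_per f1"
    unfolding f1_def by (intro even_per_zero_mean even_per_prim c2 o2)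
  show "odd_per (h3_prim_fun f)"
    unfolding f0 by (intro odd_per_prim c1 e1) (auto simp: f1_def prim_zero_mean continuous_on_prim c2)
  show "(f2 has_real_derivative f3 x) (at x)" "(f1 has_real_derivative f2 x) (at x)"
    "(h3_prim_fun f has_real_derivative f1 x) (at x)"
    unfolding f0 f2_def f1_def
    by (intro has_real_derivative_zero_mean has_real_derivative_prim
        c1[unfolded f1_def f2_def] c2[unfolded f2_def] c3)+
qed

lemma h3_prim_fun_mem: "h3_prim_fun f \<in> H3_per \<inter> sine_series"
proof
  note c = h3_prim_fun_chain[of f]
  show "h3_prim_fun f \<in> sine_series"
    by (rule odd_per_imp_sine_series[OF c(8) c(4)])
  show "h3_prim_fun f \<in> H3_per"
    by (rule H3_per_derivI[OF _ _ c(11) c(10) c(9) c(1)]) (use c(5,8) in \<open>auto simp: even_per_def odd_per_def\<close>)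
qed

lemma h3_fun_h3_prim: "h3_fun (h3_prim f) = h3_prim_fun f"
  unfolding h3_prim_def by (rule Abs_h3_odd_inverse[OF h3_prim_fun_mem])

lemma h3_prim_fun_lincomb:
  "h3_prim_fun (a *\<^sub>R f + b *\<^sub>R g) = (\<lambda>x. a * h3_prim_fun f x + b * h3_prim_fun g x)"
proof -
  have "(\<lambda>x. apply_bcontfun (a *\<^sub>R f + b *\<^sub>R g) (tri x)) = (\<lambda>x. a * f (tri x) + b * g (tri x))" by simp
  moreover have "prim (\<lambda>x. a * u x + b * v x) = (\<lambda>x. a * prim u x + b * prim v x)"
    if "continuous_on UNIV u" "continuous_on UNIV v" for u v
    by (rule ext) (rule prim_lincomb[OF that])
  ultimately show ?thesis
    unfolding h3_prim_fun_def
    by (simp add: zero_mean_lincomb continuous_on_bcontfun_tri continuous_on_zero_mean continuous_on_prim)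
qed

text \<open>Each \<open>zero_mean\<close> doubles a sup bound and each \<open>prim\<close>
  multiplies it by 2 * pi. This gives the factors 2, 4 pi, 16 pi^2, 32 pi^3 from the third
  derivative down to the function; the outer 2 * pi is the length of the period.\<close>

lemma norm_h3_prim_le:
  "norm (h3_prim f) \<le> norm f * sqrt (2 * pi * ((32 * pi ^ 3)\<^sup>2 + (16 * pi\<^sup>2)\<^sup>2 + (4 * pi)\<^sup>2 + 2\<^sup>2))"
proof -
  define f3 where "f3 = zero_mean (\<lambda>x. f (tri x))"
  define f2 where "f2 = prim f3"
  define f1 where "f1 = zero_mean (prim f2)"
  define f0 where "f0 = h3_prim_fun f"
  define N where "N = norm f"
  note c = h3_prim_fun_chain[of f, folded f3_def, folded f2_def, folded f1_def, folded f0_def]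
  have f0: "f0 = prim f1" by (simp only: f0_def h3_prim_fun_def f1_def f2_def f3_def)
  have per: "\<And>x. f0 (x + 2 * pi) = f0 x" "\<And>x. f3 (x + 2 * pi) = f3 x"
    using c(5,8) by (auto simp: even_per_def odd_per_def)
  note d = deriv_H3_per_derivI[OF per c(11,10,9,1)]
  note w = weak_deriv_H3_per_derivI[OF per c(11,10,9,1)]
  have b3: "\<bar>f3 x\<bar> \<le> 2 * N" if "x \<in> {0..2 * pi}" for x
    unfolding f3_def N_def
    by (rule abs_zero_mean_le[OF continuous_on_bcontfun_tri abs_apply_bcontfun_le that])
  have b2: "\<bar>f2 x\<bar> \<le> 2 * pi * (2 * N)" if "x \<in> {0..2 * pi}" for x
    unfolding f2_def by (rule abs_prim_le_two_pi[OF c(1) b3 that])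
  have b1: "\<bar>f1 x\<bar> \<le> 2 * (2 * pi * (2 * pi * (2 * N)))" if "x \<in> {0..2 * pi}" for x
    unfolding f1_def
    by (rule abs_zero_mean_le[OF continuous_on_prim[OF c(2)] abs_prim_le_two_pi[OF c(2) b2] that])
  have b0: "\<bar>f0 x\<bar> \<le> 2 * pi * (2 * (2 * pi * (2 * pi * (2 * N))))" if "x \<in> {0..2 * pi}" for x
    unfolding f0 by (rule abs_prim_le_two_pi[OF c(3) b1 that])
  have "L2_inner (weak_deriv f2) (weak_deriv f2) = L2_inner f3 f3"
  proof -
    \<comment> \<open>\<open>weak_deriv\<close> is a choice and matches f3 only almost everywhere;
      the coefficients 1 and 0 bring this into the form of \<open>L2_inner_lincomb\<close>.\<close>
    have ae: "AE x in lborel. weak_deriv f2 x = 1 * f3 x + 0 * f3 x"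
      using is_weak_deriv_unique[OF is_weak_deriv_weak_deriv[OF w] w] by simp
    have L: "f3 \<in> L2_per" "weak_deriv f2 \<in> L2_per"
      using w is_weak_deriv_weak_deriv[OF w] by (auto simp: is_weak_deriv_def)
    show ?thesis
      using L2_inner_lincomb[OF L(1,1,2,2) ae] L2_inner_lincomb[OF L(1,1,1,2) ae]
      by (simp add: L2_inner_commute)
  qed
  then have "H3_inner f0 f0 = L2_inner f0 f0 + L2_inner f1 f1 + L2_inner f2 f2 + L2_inner f3 f3"
    by (simp add: H3_inner_def d)
  also have "\<dots> \<le> 2 * pi * (2 * pi * (2 * (2 * pi * (2 * pi * (2 * N)))))\<^sup>2
      + 2 * pi * (2 * (2 * pi * (2 * pi * (2 * N))))\<^sup>2 + 2 * pi * (2 * pi * (2 * N))\<^sup>2 + 2 * pi * (2 * N)\<^sup>2"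
    by (intro add_mono L2_inner_self_le c b0 b1 b2 b3)
  also have "\<dots> = N\<^sup>2 * (2 * pi * ((32 * pi ^ 3)\<^sup>2 + (16 * pi\<^sup>2)\<^sup>2 + (4 * pi)\<^sup>2 + 2\<^sup>2))"
    by (simp add: power_mult_distrib power2_eq_square power3_eq_cube algebra_simps)
  finally have "sqrt (H3_inner f0 f0) \<le> sqrt (N\<^sup>2 * (2 * pi * ((32 * pi ^ 3)\<^sup>2 + (16 * pi\<^sup>2)\<^sup>2 + (4 * pi)\<^sup>2 + 2\<^sup>2)))"
    by (rule real_sqrt_le_mono)
  also have "\<dots> = N * sqrt (2 * pi * ((32 * pi ^ 3)\<^sup>2 + (16 * pi\<^sup>2)\<^sup>2 + (4 * pi)\<^sup>2 + 2\<^sup>2))"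
    by (subst real_sqrt_mult) (simp add: N_def)
  finally show ?thesis
    by (simp add: norm_h3_odd_def inner_h3_odd_def h3_fun_h3_prim f0_def N_def)
qed

text \<open>Turns C1 dependence of the third derivative in the sup norm into C1 dependence of
  \<theta> in H^3.\<close>

lemma bounded_linear_h3_prim: "bounded_linear h3_prim"
proof (rule bounded_linear_intro[OF _ _ norm_h3_prim_le])
  show "h3_prim (f + g) = h3_prim f + h3_prim g" for f g
    using h3_prim_fun_lincomb[of 1 f 1 g]
    by (simp add: h3_fun_inject[symmetric] h3_fun_plus h3_fun_h3_prim)
  show "h3_prim (r *\<^sub>R f) = r *\<^sub>R h3_prim f" for r f
    using h3_prim_fun_lincomb[of r f 0 f]
    by (simp add: h3_fun_inject[symmetric] h3_fun_scaleR h3_fun_h3_prim)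
qed

section \<open>The fixed point formulation\<close>

lemma C1_map_ident: "C1_map (\<lambda>x. x)"
  by (rule bounded_linear_imp_C1_map[OF bounded_linear_ident])

lemma bc_fold_even_per: "continuous_on UNIV h \<Longrightarrow> even_per h \<Longrightarrow> bc_fold h x = h x"
  by (simp add: bc_fold_apply even_per_tri)

definition bc_even :: "(real \<Rightarrow>\<^sub>C real) \<Rightarrow> real \<Rightarrow>\<^sub>C real" where
  "bc_even f = bc_fold (apply_bcontfun f)"

lemma bc_even_apply: "bc_even f x = f (tri x)"
  unfolding bc_even_def by (rule bc_fold_apply) simp

lemma bounded_linear_bc_even: "bounded_linear bc_even"
  by (rule bounded_linear_intro[where K=1])
    (auto intro!: bcontfun_eqI norm_bound simp: bc_even_apply abs_apply_bcontfun_le)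

definition mean :: "(real \<Rightarrow>\<^sub>C real) \<Rightarrow> real" where
  "mean f = prim f pi / pi"

lemma bounded_linear_mean: "bounded_linear mean"
  unfolding mean_def[abs_def]
  by (rule bounded_linear_compose[OF bounded_linear_divide bounded_linear_prim]) simp

lemma mean_eqI:
  assumes "F 0 = 0" "\<And>x. (F has_real_derivative h x) (at x)" "continuous_on UNIV h"
    "\<And>x. 0 \<le> x \<Longrightarrow> x \<le> pi \<Longrightarrow> apply_bcontfun f x = h x"
  shows "mean f = F pi / pi"
proof -
  have "prim (apply_bcontfun f) pi = prim h pi"
    by (rule prim_cong) (use assms in auto)
  then show ?thesis using prim_eqI[of h F pi] assms by (simp add: mean_def)
qed

abbreviation bc_one :: "real \<Rightarrow>\<^sub>C real" where
  "bc_one \<equiv> const_bcontfun 1"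

lemma mean_one: "mean bc_one = 1"
  using mean_eqI[of "\<lambda>x. x" "\<lambda>_. 1" bc_one] by simp

text \<open>
  The unknown is \<open>w = \<theta>''' / \<omega>\<close>, from which the lower derivatives are recovered by integration on
  \<open>[0, \<pi>]\<close> followed by even reflection.
\<close>

definition slope :: "(real \<Rightarrow>\<^sub>C real) \<Rightarrow> real \<Rightarrow>\<^sub>C real" where
  "slope w = bc_prim (bc_prim w) - mean (bc_prim (bc_prim w)) *\<^sub>R bc_one"

text \<open>At a fixed point this is u on [0, pi]; elsewhere it is the even reflection of the odd
  function u, which leaves cos (\<omega> u) unchanged.\<close>

definition angle :: "(real \<Rightarrow>\<^sub>C real) \<Rightarrow> real \<Rightarrow>\<^sub>C real" where
  "angle w = bc_prim (slope w)"

text \<open>The reciprocal of \<open>s_\<sigma>\<close> for \<theta> = \<omega> u; averaging over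
  [0, pi] suffices because cos \<theta> is even.\<close>

definition inv_s :: "real \<Rightarrow> (real \<Rightarrow>\<^sub>C real) \<Rightarrow> real" where
  "inv_s \<omega> w = mean (bc_compose cos (\<omega> *\<^sub>R angle w))"

lemma bounded_linear_slope: "bounded_linear slope"
  unfolding slope_def[abs_def]
  by (intro bounded_linear_sub bounded_linear_scaleR_const
      bounded_linear_compose[OF bounded_linear_mean] bounded_linear_compose[OF bounded_linear_bc_prim]
      bounded_linear_bc_prim)

lemma bounded_linear_angle: "bounded_linear angle"
  unfolding angle_def[abs_def]
  by (intro bounded_linear_compose[OF bounded_linear_bc_prim] bounded_linear_slope)

text \<open>The last assumption is q'(\<open>\<alpha>\<^sub>0\<close>) \<noteq> 0, the
  transversality condition of the bifurcation.\<close>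

locale flame_bifurcation =
  fixes k :: nat and \<alpha>\<^sub>0 :: real
  assumes k: "k \<ge> 1"
    and root: "\<alpha>\<^sub>0 - 1 = \<alpha>\<^sub>0\<^sup>2 * (\<alpha>\<^sub>0 + 3) * (real k)\<^sup>2"
    and transversal: "1 - (3 * \<alpha>\<^sub>0\<^sup>2 + 6 * \<alpha>\<^sub>0) * (real k)\<^sup>2 \<noteq> 0"
begin

definition D\<^sub>0 :: real where
  "D\<^sub>0 = \<alpha>\<^sub>0\<^sup>2 * (\<alpha>\<^sub>0 + 3)"

definition q\<^sub>1 :: real where
  "q\<^sub>1 = 1 - (3 * \<alpha>\<^sub>0\<^sup>2 + 6 * \<alpha>\<^sub>0) * (real k)\<^sup>2"

text \<open>If \<open>D\<^sub>0\<close> vanished, the root equation would leave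
  \<open>\<alpha>\<^sub>0\<close> = 1, where \<open>D\<^sub>0\<close> is 4.\<close>

lemma nonzero: "D\<^sub>0 \<noteq> 0" "q\<^sub>1 \<noteq> 0" "real k \<noteq> 0"
proof -
  show "D\<^sub>0 \<noteq> 0"
  proof
    assume "D\<^sub>0 = 0"
    moreover have "\<alpha>\<^sub>0 - 1 = D\<^sub>0 * (real k)\<^sup>2" using root by (simp add: D\<^sub>0_def)
    ultimately have "\<alpha>\<^sub>0 = 1" by simp
    with \<open>D\<^sub>0 = 0\<close> show False unfolding D\<^sub>0_def by simp
  qed
qed (use k transversal in \<open>auto simp: q\<^sub>1_def\<close>)

section \<open>The critical mode and the inverse of the linearised operator\<close>

definition kos :: "real \<Rightarrow>\<^sub>C real" where
  "kos = bc_fold (\<lambda>x. cos (real k * x))"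

text \<open>The even reflection of an odd function. In \<open>green\<close> it is either multiplied
  by an equally reflected odd factor, so that the wrong signs cancel, or integrated within
  [0, pi].\<close>

definition kin :: "real \<Rightarrow>\<^sub>C real" where
  "kin = bc_fold (\<lambda>x. sin (real k * x))"

lemma even_per_cos: "even_per (\<lambda>x. cos (real k * x))"
proof -
  have "cos (real k * (x + 2 * pi)) = cos (real k * x)" for x
  proof -
    have "real k * (x + 2 * pi) = real k * x + 2 * real k * pi" by (simp add: algebra_simps)
    then show ?thesis by (simp only: cos_add) simp
  qed
  then show ?thesis by (simp add: even_per_def)
qed

lemma odd_per_sin: "odd_per (\<lambda>x. sin (real k * x))"
proof -
  have "sin (real k * (x + 2 * pi)) = sin (real k * x)" for x
  proof -
    have "real k * (x + 2 * pi) = real k * x + 2 * real k * pi" by (simp add: algebra_simps)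
    then show ?thesis by (simp only: sin_add) simp
  qed
  then show ?thesis by (simp add: odd_per_def)
qed

lemma kos_apply: "kos x = cos (real k * x)"
  unfolding kos_def by (rule bc_fold_even_per[OF _ even_per_cos]) (auto intro: continuous_intros)

lemma kos_tri: "kos (tri x) = kos x"
  using even_per_tri[OF even_per_cos] by (simp add: kos_apply)

lemma kin_apply: "kin x = sin (real k * tri x)"
  unfolding kin_def by (rule bc_fold_apply) (auto intro: continuous_intros)

lemma mean_kos: "mean kos = 0"
  using mean_eqI[of "\<lambda>x. sin (real k * x) / real k" "\<lambda>x. cos (real k * x)" kos] nonzero
  by (force intro!: derivative_eq_intros continuous_intros simp: kos_apply mult.commute)

lemma mean_kos_kos: "mean (bc_mult kos kos) = 1 / 2"
proof -
  have "mean (bc_mult kos kos) = (pi / 2 + sin (2 * real k * pi) / (4 * real k)) / pi"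
  proof (rule mean_eqI)
    fix x
    have "((\<lambda>x. x / 2 + sin (2 * real k * x) / (4 * real k)) has_real_derivative
        1 / 2 + cos (2 * real k * x) / 2) (at x)"
      using nonzero by (auto intro!: derivative_eq_intros simp: field_simps)
    moreover have "1 / 2 + cos (2 * real k * x) / 2 = cos (real k * x) * cos (real k * x)"
      using cos_double_cos[of "real k * x"] by (simp add: mult.assoc power2_eq_square diff_divide_distrib)
    ultimately show "((\<lambda>x. x / 2 + sin (2 * real k * x) / (4 * real k)) has_real_derivative
        cos (real k * x) * cos (real k * x)) (at x)"
      by (simp only:)
  qed (auto simp: kos_apply intro!: continuous_intros)
  moreover have "sin (2 * real k * pi) = 0"
    using sin_npi[of "2 * k"] by simp
  ultimately show ?thesis by simp
qed

text \<open>Orthogonal projection on [0, pi] away from 1 and cos (k x), the two directions left to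
  \<beta> and \<alpha>; the factor 2 is the reciprocal of
  \<open>mean (bc_mult kos kos)\<close>.\<close>

definition proj :: "(real \<Rightarrow>\<^sub>C real) \<Rightarrow> real \<Rightarrow>\<^sub>C real" where
  "proj f = f - mean f *\<^sub>R bc_one - (2 * mean (bc_mult f kos)) *\<^sub>R kos"

text \<open>Variation of constants for \<open>v'' + k\<^sup>2 v = f\<close> with \<open>v 0 = v' 0 = 0\<close>.\<close>

definition green :: "(real \<Rightarrow>\<^sub>C real) \<Rightarrow> real \<Rightarrow>\<^sub>C real" where
  "green f = (1 / real k) *\<^sub>R
     (bc_mult kin (bc_prim (bc_mult kos f)) - bc_mult kos (bc_prim (bc_mult kin f)))"

lemmas bounded_linear_bc_mult_left = bounded_bilinear.bounded_linear_left[OF bounded_bilinear_bc_mult]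
lemmas bounded_linear_bc_mult_right = bounded_bilinear.bounded_linear_right[OF bounded_bilinear_bc_mult]

lemma bounded_linear_proj: "bounded_linear proj"
  unfolding proj_def[abs_def]
  by (intro bounded_linear_sub bounded_linear_scaleR_const bounded_linear_ident bounded_linear_mean
      bounded_linear_const_mult bounded_linear_compose[OF bounded_linear_mean] bounded_linear_bc_mult_left)

lemma bounded_linear_green: "bounded_linear green"
  unfolding green_def[abs_def]
  by (intro bounded_linear_const_scaleR bounded_linear_sub bounded_linear_bc_mult_right
     bounded_linear_compose[OF bounded_linear_bc_mult_right]
     bounded_linear_compose[OF bounded_linear_bc_prim])

lemma proj_kos: "proj kos = 0"
  by (simp add: proj_def mean_kos mean_kos_kos)

lemma proj_one: "proj bc_one = 0"
proof -
  have "bc_mult bc_one kos = kos" by (rule bcontfun_eqI) simp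
  then show ?thesis by (simp add: proj_def mean_kos mean_one)
qed

text \<open>The kernel element u = sin (k x) / k has slope cos (k x) and third derivative - k^2 cos
  (k x), which is where the iteration starts.\<close>

lemma slope_kos: "slope (- (real k)\<^sup>2 *\<^sub>R kos) = kos"
proof -
  have "bc_prim kos x = sin (real k * tri x) / real k" for x
    unfolding bc_prim_apply
    by (rule prim_eqI) (use nonzero in \<open>auto simp: kos_apply intro!: continuous_intros derivative_eq_intros\<close>)
  then have 1: "bc_prim kos x = sin (real k * x) / real k" if "0 \<le> x" "x \<le> pi" for x
    using that by (simp add: tri_id)
  have "bc_prim (bc_prim kos) x = (1 - cos (real k * tri x)) / (real k)\<^sup>2" for x
  proof -
    have "bc_prim (bc_prim kos) x = prim (\<lambda>x. sin (real k * x) / real k) (tri x)"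
      unfolding bc_prim_apply[of "bc_prim kos"]
      by (rule prim_cong) (use 1 tri_bounds order_trans[OF _ tri_bounds(2)] nonzero in \<open>auto intro!: continuous_intros\<close>)
    also have "\<dots> = (1 - cos (real k * tri x)) / (real k)\<^sup>2"
      by (rule prim_eqI) (use nonzero in \<open>auto simp: power2_eq_square intro!: continuous_intros derivative_eq_intros\<close>)
    finally show ?thesis .
  qed
  then have "bc_prim (bc_prim kos) = (1 / (real k)\<^sup>2) *\<^sub>R (bc_one - kos)"
    by (intro bcontfun_eqI) (simp add: kos_apply kos_tri[unfolded kos_apply])
  moreover have "mean (bc_one - kos) = 1"
    using linear_diff[OF bounded_linear.linear[OF bounded_linear_mean]] by (simp add: mean_one mean_kos)
  ultimately have "slope kos = - (1 / (real k)\<^sup>2) *\<^sub>R kos"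
    using linear_scale[OF bounded_linear.linear[OF bounded_linear_mean], of "1 / (real k)\<^sup>2" "bc_one - kos"]
    by (simp add: slope_def scaleR_diff_right)
  then show ?thesis
    using linear_scale[OF bounded_linear.linear[OF bounded_linear_slope], of "- (real k)\<^sup>2" kos] nonzero
    by simp
qed

text \<open>
  With \<open>\<theta> = \<omega> u\<close>, \<open>u' = v\<close>, \<open>u''' = w\<close>, \<open>\<alpha> = \<alpha>\<^sub>0 + a\<close> and \<open>\<beta> = 1 + \<omega> b\<close>, the function \<open>F / \<omega>\<close> equals
  \<open>D\<^sub>0 (w + k\<^sup>2 v + residual)\<close>. The quotient \<open>(1 - cos (\<omega> u)) / \<omega>\<close> is written as the primitive of
  \<open>v sin (\<omega> u)\<close>, so that nothing is divided by \<open>\<omega>\<close>.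
\<close>

definition residual :: "real \<Rightarrow> (real \<Rightarrow>\<^sub>C real) \<Rightarrow> real \<Rightarrow> real \<Rightarrow> real \<Rightarrow>\<^sub>C real" where
  "residual \<omega> w a b = (1 / D\<^sub>0) *\<^sub>R
    (((\<alpha>\<^sub>0 + a)\<^sup>2 * (\<alpha>\<^sub>0 + a + 3) * inv_s \<omega> w ^ 3 - D\<^sub>0) *\<^sub>R bc_even w
     + ((\<alpha>\<^sub>0 + a - 1) * inv_s \<omega> w - D\<^sub>0 * (real k)\<^sup>2) *\<^sub>R slope w
     + ((1 + (\<alpha>\<^sub>0 + a) / 2) * (inv_s \<omega> w)\<^sup>2 * \<omega>) *\<^sub>R bc_mult (slope w) (slope w)
     + ((2 * (\<alpha>\<^sub>0 + a) + 5 * (\<alpha>\<^sub>0 + a)\<^sup>2 - (\<alpha>\<^sub>0 + a) ^ 3 / 3) * inv_s \<omega> w ^ 3 * \<omega>\<^sup>2) *\<^sub>R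
         bc_mult (slope w) (bc_mult (slope w) (slope w))
     + bc_prim (bc_mult (slope w) (bc_compose sin (\<omega> *\<^sub>R angle w)))
     - b *\<^sub>R bc_compose cos (\<omega> *\<^sub>R angle w))"

text \<open>Solving w + k^2 v + g = 0 with v = \<open>kos - green g\<close> gives w = - k^2
  \<open>kos\<close> plus the first component, once g is projected. The other two are Newton
  corrections: to first order at \<omega> = 0 the residual is (a \<open>q\<^sub>1\<close>
  \<open>kos\<close> - b) / \<open>D\<^sub>0\<close>, and their constants invert this dependence on
  a and b.\<close>

definition corrector :: "(real \<Rightarrow>\<^sub>C real) \<Rightarrow> (real \<Rightarrow>\<^sub>C real) \<times> real \<times> real" where
  "corrector g = ((real k)\<^sup>2 *\<^sub>R green (proj g) - proj g,
     - (2 * D\<^sub>0 / q\<^sub>1) * mean (bc_mult g kos), D\<^sub>0 * mean g)"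

definition step :: "real \<times> (real \<Rightarrow>\<^sub>C real) \<times> real \<times> real \<Rightarrow> (real \<Rightarrow>\<^sub>C real) \<times> real \<times> real" where
  "step p = (- (real k)\<^sup>2 *\<^sub>R kos, fst (snd (snd p)), snd (snd (snd p)))
     + corrector (residual (fst p) (fst (snd p)) (fst (snd (snd p))) (snd (snd (snd p))))"

lemma bounded_linear_corrector: "bounded_linear corrector"
  unfolding corrector_def[abs_def]
  by (intro bounded_linear_Pair bounded_linear_sub bounded_linear_const_scaleR bounded_linear_proj
      bounded_linear_compose[OF bounded_linear_green] bounded_linear_const_mult bounded_linear_mean
      bounded_linear_compose[OF bounded_linear_mean] bounded_linear_bc_mult_left)

lemma C1_map_step: "C1_map step"
  unfolding step_def[abs_def] residual_def inv_s_def
  by (intro C1_map_const C1_map_ident C1_map_add C1_map_diff C1_map_Pair C1_map_scaleR C1_map_mult C1_map_power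
      bounded_bilinear.C1_map[OF bounded_bilinear_bc_mult]
      C1_map_compose[OF C1_map_bc_sin] C1_map_compose[OF C1_map_bc_cos]
      C1_map_linear_compose[OF bounded_linear_divide]
      C1_map_linear_compose[OF bounded_linear_fst] C1_map_linear_compose[OF bounded_linear_snd]
      C1_map_linear_compose[OF bounded_linear_corrector] C1_map_linear_compose[OF bounded_linear_mean]
      C1_map_linear_compose[OF bounded_linear_slope] C1_map_linear_compose[OF bounded_linear_angle]
      C1_map_linear_compose[OF bounded_linear_bc_prim] C1_map_linear_compose[OF bounded_linear_bc_even])

text \<open>The perturbation t w occurs only with factors that vanish at t = 0, so it contributes at
  second order; this is why only a and b survive in the derivative.\<close>

lemma residual_0:
  "residual 0 (- (real k)\<^sup>2 *\<^sub>R kos + t *\<^sub>R w) (t * a) (t * b) = (1 / D\<^sub>0) *\<^sub>R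
    (((\<alpha>\<^sub>0 + t * a)\<^sup>2 * (\<alpha>\<^sub>0 + t * a + 3) - D\<^sub>0) *\<^sub>R (- (real k)\<^sup>2 *\<^sub>R kos + t *\<^sub>R bc_even w)
     + (t * a) *\<^sub>R (kos + t *\<^sub>R slope w) - (t * b) *\<^sub>R bc_one)"
proof -
  have sl: "slope (- (real k)\<^sup>2 *\<^sub>R kos + t *\<^sub>R w) = kos + t *\<^sub>R slope w"
    unfolding linear_add[OF bounded_linear.linear[OF bounded_linear_slope]]
      linear_scale[OF bounded_linear.linear[OF bounded_linear_slope], of t w] slope_kos ..
  have ev: "bc_even (- (real k)\<^sup>2 *\<^sub>R kos + t *\<^sub>R w) = - (real k)\<^sup>2 *\<^sub>R kos + t *\<^sub>R bc_even w"
    by (rule bcontfun_eqI) (simp add: bc_even_apply kos_tri)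
  have c: "bc_compose cos 0 = bc_one" "bc_mult f (bc_compose sin 0) = 0" for f
    by (rule bcontfun_eqI, simp)+
  have z: "bc_prim 0 = 0"
    using linear_0[OF bounded_linear.linear[OF bounded_linear_bc_prim]] .
  have "\<alpha>\<^sub>0 + t * a - 1 - D\<^sub>0 * (real k)\<^sup>2 = t * a"
    using root by (simp add: D\<^sub>0_def)
  then show ?thesis
    unfolding residual_def inv_s_def sl ev by (simp add: c z mean_one)
qed

lemma step_0: "step (0, - (real k)\<^sup>2 *\<^sub>R kos, 0, 0) = (- (real k)\<^sup>2 *\<^sub>R kos, 0, 0)"
proof -
  have "residual 0 (- (real k)\<^sup>2 *\<^sub>R kos) 0 0 = 0"
    using residual_0[of 0 0 0 0] by (simp add: D\<^sub>0_def)
  then show ?thesis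
    using linear_0[OF bounded_linear.linear[OF bounded_linear_corrector]]
    by (simp add: step_def flip: zero_prod_def)
qed

text \<open>On the first-order residual \<open>corrector\<close> takes the value (0, - a, - b),
  which cancels the first-order change of the unknowns carried along by \<open>step\<close>.\<close>

lemma step_deriv_0:
  "((\<lambda>t. step (0, (- (real k)\<^sup>2 *\<^sub>R kos, 0, 0) + t *\<^sub>R h)) has_vector_derivative 0) (at 0)"
proof -
  obtain w a b where h: "h = (w, a, b)" by (cases h)
  define g where "g t = residual 0 (- (real k)\<^sup>2 *\<^sub>R kos + t *\<^sub>R w) (t * a) (t * b)" for t
  \<comment> \<open>The factor of \<open>kos\<close> combines 1, from \<alpha> - 1, with - k^2 times
    the derivative of \<alpha>^2 (\<alpha> + 3): this is q' at
    \<open>\<alpha>\<^sub>0\<close>.\<close>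
  define g' where "g' = (1 / D\<^sub>0) *\<^sub>R ((a * q\<^sub>1) *\<^sub>R kos - b *\<^sub>R bc_one)"
  have "(g has_vector_derivative (1 / D\<^sub>0) *\<^sub>R
      (((2 * \<alpha>\<^sub>0 * a * (\<alpha>\<^sub>0 + 3) + \<alpha>\<^sub>0\<^sup>2 * a) *\<^sub>R (- (real k)\<^sup>2 *\<^sub>R kos) + a *\<^sub>R kos) - b *\<^sub>R bc_one)) (at 0)"
    unfolding g_def residual_0
    by (rule has_vector_derivative_eq_rhs)
      (auto intro!: derivative_eq_intros simp: D\<^sub>0_def)
  also have "(1 / D\<^sub>0) *\<^sub>R (((2 * \<alpha>\<^sub>0 * a * (\<alpha>\<^sub>0 + 3) + \<alpha>\<^sub>0\<^sup>2 * a) *\<^sub>R (- (real k)\<^sup>2 *\<^sub>R kos) + a *\<^sub>R kos)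
      - b *\<^sub>R bc_one) = g'"
    unfolding g'_def q\<^sub>1_def
    by (intro arg_cong[where f="\<lambda>x. (1 / D\<^sub>0) *\<^sub>R x"] bcontfun_eqI) (simp add: algebra_simps power2_eq_square)
  finally have g: "(g has_vector_derivative g') (at 0)" .
  have "mean (bc_mult g' kos) = a * q\<^sub>1 / (2 * D\<^sub>0)"
  proof -
    have "bc_mult g' kos = (a * q\<^sub>1 / D\<^sub>0) *\<^sub>R bc_mult kos kos - (b / D\<^sub>0) *\<^sub>R kos"
      by (rule bcontfun_eqI) (simp add: g'_def field_simps)
    then show ?thesis
      by (simp add: linear_diff[OF bounded_linear.linear[OF bounded_linear_mean]]
          linear_scale[OF bounded_linear.linear[OF bounded_linear_mean]] mean_kos mean_kos_kos)
  qed
  moreover have "mean g' = - b / D\<^sub>0"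
    by (simp add: g'_def linear_diff[OF bounded_linear.linear[OF bounded_linear_mean]]
          linear_scale[OF bounded_linear.linear[OF bounded_linear_mean]] mean_kos mean_one)
  moreover have "proj g' = 0"
    by (simp add: g'_def linear_diff[OF bounded_linear.linear[OF bounded_linear_proj]]
          linear_scale[OF bounded_linear.linear[OF bounded_linear_proj]] proj_kos proj_one)
  ultimately have "corrector g' = (0, - a, - b)"
    using nonzero linear_0[OF bounded_linear.linear[OF bounded_linear_green]] by (simp add: corrector_def)
  moreover have "((\<lambda>t. (- (real k)\<^sup>2 *\<^sub>R kos, t * a, t * b)) has_vector_derivative (0, a, b)) (at 0)"
    by (intro has_vector_derivative_Pair) (auto intro!: derivative_eq_intros simp: has_real_derivative_iff_has_vector_derivative[symmetric])
  ultimately have "((\<lambda>t. (- (real k)\<^sup>2 *\<^sub>R kos, t * a, t * b) + corrector (g t)) has_vector_derivative 0) (at 0)"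
    using has_vector_derivative_add[OF _ bounded_linear.has_vector_derivative[OF bounded_linear_corrector g]]
    by (fastforce simp: zero_prod_def)
  then show ?thesis
    by (simp add: step_def h g_def)
qed

end

section \<open>Fixed points are traveling waves\<close>

lemma even_per_mult_even: "even_per f \<Longrightarrow> even_per g \<Longrightarrow> even_per (\<lambda>x. f x * g x)"
  and odd_per_mult: "even_per f \<Longrightarrow> odd_per g \<Longrightarrow> odd_per (\<lambda>x. f x * g x)"
  by (simp_all add: even_per_def odd_per_def)

lemma even_per_bcontfunI: "(\<And>x. apply_bcontfun f (tri x) = f x) \<Longrightarrow> even_per (apply_bcontfun f)"
  using even_per_compose_tri[of "apply_bcontfun f"] by simp

lemma tri_tri: "tri (tri x) = tri x"
  by (rule tri_id[OF tri_bounds])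

context flame_bifurcation
begin

lemma residual_tri: "residual \<omega> w a b (tri x) = residual \<omega> w a b x"
  unfolding residual_def slope_def angle_def inv_s_def
  by (simp add: bc_even_apply bc_prim_apply tri_tri)

text \<open>Here the solvability conditions pay off. Orthogonality of g to cos (k x) makes A
  periodic, so V is truly even and periodic; integrating V'' + k^2 V = - g over [0, pi] then shows
  that V has mean zero, as the slope of a periodic angle must.\<close>

lemma step_fixed_point:
  assumes fp: "step (\<omega>, w, a, b) = (w, a, b)"
  obtains V V1 where
    "continuous_on UNIV V" "even_per V" "V 0 = 1" "prim V pi = 0"
    "continuous_on UNIV V1" "odd_per V1" "V1 0 = 0"
    "\<And>x. (V has_real_derivative V1 x) (at x)" "\<And>x. (V1 has_real_derivative w x) (at x)"
    "\<And>x. w x = - (real k)\<^sup>2 * V x - residual \<omega> w a b x" "even_per (apply_bcontfun w)"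
proof -
  define g where "g = residual \<omega> w a b"
  \<comment> \<open>The second and third components of \<open>step\<close> add nonzero multiples of
    these means to a and b.\<close>
  have g0: "mean (bc_mult g kos) = 0" "mean g = 0"
    using fp nonzero by (auto simp: step_def corrector_def g_def)
  then have "proj g = g" by (simp add: proj_def)
  then have w: "w = - (real k)\<^sup>2 *\<^sub>R kos + ((real k)\<^sup>2 *\<^sub>R green g - g)"
    using fp by (simp add: step_def corrector_def g_def)
  have g: "even_per (apply_bcontfun g)"
    by (rule even_per_bcontfunI) (simp add: g_def residual_tri)
  define A where "A = prim (\<lambda>x. cos (real k * x) * g x)"
  define B where "B = prim (\<lambda>x. sin (real k * x) * g x)"
  have cA: "continuous_on UNIV (\<lambda>x. cos (real k * x) * g x)" and cB: "continuous_on UNIV (\<lambda>x. sin (real k * x) * g x)"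
    by (auto intro!: continuous_intros)
  have A: "odd_per A" unfolding A_def
  proof (rule odd_per_prim[OF cA even_per_mult_even[OF even_per_cos g]])
    have "apply_bcontfun (bc_mult g kos) = (\<lambda>x. cos (real k * x) * g x)"
      by (rule ext) (simp add: kos_apply)
    then show "prim (\<lambda>x. cos (real k * x) * g x) pi = 0"
      using g0(1) by (simp add: mean_def)
  qed
  have B: "even_per B" unfolding B_def
    using odd_per_mult[OF g odd_per_sin] by (intro even_per_prim cB) (simp add: mult.commute)
  have dA: "(A has_real_derivative cos (real k * x) * g x) (at x)"
    and dB: "(B has_real_derivative sin (real k * x) * g x) (at x)" for x
    unfolding A_def B_def by (rule has_real_derivative_prim[OF cA], rule has_real_derivative_prim[OF cB])
  have A0: "A 0 = 0" and B0: "B 0 = 0"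
    unfolding A_def B_def by (rule prim_0[OF cA], rule prim_0[OF cB])
  \<comment> \<open>\<open>kos - green g\<close> with the true odd sine in place of its reflection,
    hence differentiable everywhere.\<close>
  define V where "V x = cos (real k * x) - (sin (real k * x) * A x - cos (real k * x) * B x) / real k" for x
  define V1 where "V1 x = - real k * sin (real k * x) - cos (real k * x) * A x - sin (real k * x) * B x" for x
  have dV: "(V has_real_derivative V1 x) (at x)" for x
    unfolding V_def[abs_def] V1_def using nonzero
    by (auto intro!: derivative_eq_intros dA dB simp: field_simps)
  have dV1: "(V1 has_real_derivative - (real k)\<^sup>2 * V x - g x) (at x)" for x
  proof -
    have "(V1 has_real_derivative - (real k)\<^sup>2 * V x
        - (cos (real k * x) * (cos (real k * x) * g x) + sin (real k * x) * (sin (real k * x) * g x))) (at x)"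
      unfolding V_def V1_def[abs_def] using nonzero
      by (auto intro!: derivative_eq_intros dA dB simp: field_simps power2_eq_square)
    moreover have "cos (real k * x) * (cos (real k * x) * g x) + sin (real k * x) * (sin (real k * x) * g x) = g x"
      by (metis distrib_right mult.assoc mult_1 sin_cos_squared_add3)
    ultimately show ?thesis by simp
  qed
  have eV: "even_per V"
    using A B even_per_cos odd_per_sin by (simp add: V_def even_per_def odd_per_def)
  have oV1: "odd_per V1"
    using A B even_per_cos odd_per_sin by (simp add: V1_def even_per_def odd_per_def)
  have cV: "continuous_on UNIV V" and cV1: "continuous_on UNIV V1"
    using dV dV1 by (meson DERIV_isCont continuous_at_imp_continuous_on)+
  have kgV: "kos x - green g x = V x" for x
  proof (rule even_per_eqI[of "\<lambda>x. kos x - green g x" V])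
    have "green g (tri x) = green g x" for x
      by (simp add: green_def kos_tri kin_apply bc_prim_apply tri_tri)
    then have "even_per (\<lambda>x. green g x)" by (rule even_per_bcontfunI)
    moreover have "even_per (\<lambda>x. kos x)" by (rule even_per_bcontfunI) (rule kos_tri)
    ultimately show "even_per (\<lambda>x. kos x - green g x)" by (simp add: even_per_def)
    fix x :: real assume x: "0 \<le> x" "x \<le> pi"
    have "bc_prim (bc_mult kos g) x = A x"
      unfolding bc_prim_apply A_def tri_id[OF x]
      by (rule prim_cong[OF continuous_on_apply_bcontfun cA]) (use x in \<open>auto simp: kos_apply\<close>)
    moreover have "bc_prim (bc_mult kin g) x = B x"
      unfolding bc_prim_apply B_def tri_id[OF x]
      by (rule prim_cong[OF continuous_on_apply_bcontfun cB]) (use x in \<open>auto simp: kin_apply tri_id\<close>)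
    ultimately show "kos x - green g x = V x"
      using x by (simp add: green_def V_def kos_apply kin_apply tri_id)
  qed (rule eV)
  have wV: "w x = - (real k)\<^sup>2 * V x - g x" for x
    unfolding kgV[symmetric] by (subst w) (simp add: algebra_simps)
  \<comment> \<open>At pi the odd function V1 vanishes, and so does the primitive of g because its
    mean is 0; only the integral of V remains.\<close>
  have "prim (apply_bcontfun g) pi = - (V1 pi + (real k)\<^sup>2 * prim V pi)"
  proof (rule prim_eqI[where F="\<lambda>x. - (V1 x + (real k)\<^sup>2 * prim V x)"])
    show "((\<lambda>x. - (V1 x + (real k)\<^sup>2 * prim V x)) has_real_derivative g x) (at x)" for x
      by (auto intro!: derivative_eq_intros dV1 has_real_derivative_prim[OF cV])
  qed (simp_all add: prim_0[OF cV] V1_def A0)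
  then have "prim V pi = 0"
    using g0(2) odd_per_pi[OF oV1] nonzero by (simp add: mean_def)
  show thesis
  proof (rule that[OF cV eV _ \<open>prim V pi = 0\<close> cV1 oV1 _ dV])
    show "V 0 = 1" "V1 0 = 0" by (simp_all add: V_def V1_def A0 B0)
    show "(V1 has_real_derivative w x) (at x)" for x using dV1 by (simp add: wV)
    show "w x = - (real k)\<^sup>2 * V x - residual \<omega> w a b x" for x using wV by (simp add: g_def)
    show "even_per (apply_bcontfun w)"
      using eV g by (simp add: wV[abs_def] even_per_def)
  qed
qed

text \<open>U, V, V1, w are u and its first three derivatives. Once the reflected operators are
  identified with them, F is \<omega> \<open>D\<^sub>0\<close> (w + k^2 V + residual), which
  vanishes wherever the chosen weak derivative equals \<omega> w.\<close>

lemma step_fixed_point_solution: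
  assumes fp: "step (\<omega>, w, a, b) = (w, a, b)" and pos: "inv_s \<omega> w > 0"
  shows "flame_F_zero (\<omega> *\<^sub>R h3_prim w, 1 + \<omega> * b, \<alpha>\<^sub>0 + a)"
    and "odd_per (h3_fun (\<omega> *\<^sub>R h3_prim w))"
    and "\<omega> \<noteq> 0 \<Longrightarrow> \<omega> *\<^sub>R h3_prim w \<noteq> 0"
proof -
  obtain V V1 where cV: "continuous_on UNIV V" and eV: "even_per V" and V0: "V 0 = 1" and MV: "prim V pi = 0"
    and cV1: "continuous_on UNIV V1" and oV1: "odd_per V1" and V10: "V1 0 = 0"
    and dV: "\<And>x. (V has_real_derivative V1 x) (at x)" and dV1: "\<And>x. (V1 has_real_derivative w x) (at x)"
    and wV: "\<And>x. w x = - (real k)\<^sup>2 * V x - residual \<omega> w a b x" and ew: "even_per (apply_bcontfun w)"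
    using step_fixed_point[OF fp] by blast
  define U where "U = prim V"
  have oU: "odd_per U" unfolding U_def by (rule odd_per_prim[OF cV eV MV])
  have cU: "continuous_on UNIV U" unfolding U_def by (rule continuous_on_prim[OF cV])
  have dU: "(U has_real_derivative V x) (at x)" for x
    unfolding U_def by (rule has_real_derivative_prim[OF cV])
  have U0: "U 0 = 0" unfolding U_def by (rule prim_0[OF cV])
  have pw: "prim (apply_bcontfun w) = V1"
    by (rule ext, rule prim_eqI) (auto simp: V10 dV1)
  have pV1: "prim V1 = (\<lambda>x. V x - 1)"
    by (rule ext, rule prim_eqI) (auto simp: cV1 V0 intro!: derivative_eq_intros dV)
  have pVm: "prim (\<lambda>x. V x - 1) x = U x - x" for x
    by (rule prim_eqI) (auto simp: U0 intro!: derivative_eq_intros dU continuous_intros cV)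
  have bpw: "bc_prim (bc_prim w) x = V (tri x) - 1" for x
  proof -
    have "bc_prim (bc_prim w) x = prim V1 (tri x)"
      unfolding bc_prim_apply[of "bc_prim w"]
    proof (rule prim_cong[OF continuous_on_apply_bcontfun cV1 tri_bounds(1)])
      fix y assume "y \<in> {0..tri x}"
      then have "0 \<le> y" "y \<le> pi" using tri_bounds(2)[of x] by auto
      then show "bc_prim w y = V1 y" by (simp add: bc_prim_apply tri_id pw)
    qed
    then show ?thesis by (simp add: pV1)
  qed
  \<comment> \<open>Since U pi = 0, the mean of V - 1 is - 1, and subtracting it in
    \<open>slope\<close> restores V.\<close>
  have "mean (bc_prim (bc_prim w)) = (U pi - pi) / pi"
    by (rule mean_eqI[where F="\<lambda>x. U x - x" and h="\<lambda>x. V x - 1"])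
      (auto simp: U0 bpw tri_id intro!: derivative_eq_intros dU continuous_intros cV)
  then have "mean (bc_prim (bc_prim w)) = - 1"
    using MV by (simp add: U_def)
  then have slope: "slope w x = V x" for x
    by (simp add: slope_def bpw even_per_tri[OF eV])
  then have slope': "apply_bcontfun (slope w) = V" by blast
  have angle: "angle w x = U (tri x)" for x
    by (simp add: angle_def bc_prim_apply slope' U_def)
  have "(\<lambda>x. w (tri x)) = apply_bcontfun w"
    by (rule ext) (rule even_per_tri[OF ew])
  then have "h3_prim_fun w = prim (zero_mean (prim (prim (zero_mean (apply_bcontfun w)))))"
    by (simp add: h3_prim_fun_def)
  also have "zero_mean (apply_bcontfun w) = apply_bcontfun w"
    using odd_per_pi[OF oV1] by (simp add: zero_mean_def[abs_def] pw)
  also have "zero_mean (prim (prim (apply_bcontfun w))) = V"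
    unfolding pw pV1 by (rule ext) (simp add: zero_mean_def pVm MV U_def)
  finally have h: "h3_fun (\<omega> *\<^sub>R h3_prim w) = (\<lambda>x. \<omega> * U x)"
    by (simp add: h3_fun_scaleR h3_fun_h3_prim U_def)
  show "odd_per (h3_fun (\<omega> *\<^sub>R h3_prim w))"
    unfolding h using oU by (simp add: odd_per_def)
  have per: "\<And>x. \<omega> * U (x + 2 * pi) = \<omega> * U x" "\<And>x. \<omega> * w (x + 2 * pi) = \<omega> * w x"
    using oU ew by (simp_all add: odd_per_def even_per_def)
  have ders: "((\<lambda>x. \<omega> * U x) has_real_derivative \<omega> * V x) (at x)"
    "((\<lambda>x. \<omega> * V x) has_real_derivative \<omega> * V1 x) (at x)"
    "((\<lambda>x. \<omega> * V1 x) has_real_derivative \<omega> * w x) (at x)" for x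
    by (auto intro!: DERIV_cmult dU dV dV1)
  have cw: "continuous_on UNIV (\<lambda>x. \<omega> * w x)" by (auto intro!: continuous_intros)
  note d = deriv_H3_per_derivI[OF per ders cw]
  note wd = weak_deriv_H3_per_derivI[OF per ders cw]
  have ae: "AE x in lborel. weak_deriv (deriv (deriv (h3_fun (\<omega> *\<^sub>R h3_prim w)))) x = \<omega> * w x"
    unfolding h d by (rule is_weak_deriv_unique[OF is_weak_deriv_weak_deriv[OF wd] wd])
  show "\<omega> *\<^sub>R h3_prim w \<noteq> 0" if "\<omega> \<noteq> 0"
  proof
    assume eq: "\<omega> *\<^sub>R h3_prim w = 0"
    have "(\<lambda>x. \<omega> * U x) = (\<lambda>_. 0)"
      unfolding h[symmetric] eq by (rule h3_fun_zero)
    then have "((\<lambda>_. 0) has_real_derivative \<omega> * V 0) (at 0)"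
      using ders(1)[of 0] by (simp only:)
    then have "\<omega> * V 0 = 0"
      using DERIV_unique DERIV_const by blast
    with that V0 show False by simp
  qed
  have cc: "continuous_on UNIV (\<lambda>x. cos (\<omega> * U x))" by (intro continuous_intros cU)
  have ec: "even_per (\<lambda>x. cos (\<omega> * U x))"
    using oU by (simp add: odd_per_def even_per_def)
  have "prim (apply_bcontfun (bc_compose cos (\<omega> *\<^sub>R angle w))) pi = prim (\<lambda>x. cos (\<omega> * U x)) pi"
    by (rule prim_cong[OF continuous_on_apply_bcontfun cc]) (auto simp: angle tri_id)
  then have "prim (\<lambda>x. cos (\<omega> * U x)) pi = pi * inv_s \<omega> w"
    by (simp add: inv_s_def mean_def)
  then have int: "(LBINT x:{0..2*pi}. cos (\<omega> * U x)) = 2 * pi * inv_s \<omega> w"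
    by (subst LBINT_eq_prim) (simp_all add: cc prim_two_pi_even[OF cc ec])
  have s: "s_\<sigma> (\<omega> *\<^sub>R h3_prim w) = 1 / inv_s \<omega> w"
    unfolding s_\<sigma>_def front_length_def h int by (simp add: power2_eq_square)
  \<comment> \<open>Undoes the rewriting of (1 - cos (\<omega> u)) / \<omega>; \<omega> = 0 is
    separate because the antiderivative used contains 1 / \<omega>.\<close>
  have "\<omega> * prim (\<lambda>x. V x * sin (\<omega> * U x)) x = 1 - cos (\<omega> * U x)" for x
  proof (cases "\<omega> = 0")
    case False
    have "prim (\<lambda>x. V x * sin (\<omega> * U x)) x = (1 - cos (\<omega> * U x)) / \<omega>"
      by (rule prim_eqI) (use False in \<open>auto simp: U0 intro!: continuous_intros cU cV derivative_eq_intros dU\<close>)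
    with False show ?thesis by simp
  qed simp
  moreover have "bc_prim (bc_mult (slope w) (bc_compose sin (\<omega> *\<^sub>R angle w))) x
      = prim (\<lambda>x. V x * sin (\<omega> * U x)) (tri x)" for x
    unfolding bc_prim_apply
  proof (rule prim_cong[OF continuous_on_apply_bcontfun _ tri_bounds(1)])
    fix y assume "y \<in> {0..tri x}"
    then have "0 \<le> y" "y \<le> pi" using tri_bounds(2)[of x] by auto
    then show "bc_mult (slope w) (bc_compose sin (\<omega> *\<^sub>R angle w)) y = V y * sin (\<omega> * U y)"
      by (simp add: slope angle tri_id)
  qed (intro continuous_intros cU cV)
  ultimately have J: "\<omega> * bc_prim (bc_mult (slope w) (bc_compose sin (\<omega> *\<^sub>R angle w))) x
      = 1 - cos (\<omega> * U x)" for x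
    using even_per_tri[OF ec, of x] by simp
  have Dres: "D\<^sub>0 * residual \<omega> w a b x =
      ((\<alpha>\<^sub>0 + a)\<^sup>2 * (\<alpha>\<^sub>0 + a + 3) * inv_s \<omega> w ^ 3 - D\<^sub>0) * w x
     + ((\<alpha>\<^sub>0 + a - 1) * inv_s \<omega> w - D\<^sub>0 * (real k)\<^sup>2) * V x
     + ((1 + (\<alpha>\<^sub>0 + a) / 2) * (inv_s \<omega> w)\<^sup>2 * \<omega>) * (V x * V x)
     + ((2 * (\<alpha>\<^sub>0 + a) + 5 * (\<alpha>\<^sub>0 + a)\<^sup>2 - (\<alpha>\<^sub>0 + a) ^ 3 / 3) * inv_s \<omega> w ^ 3 * \<omega>\<^sup>2) * (V x * (V x * V x))
     + bc_prim (bc_mult (slope w) (bc_compose sin (\<omega> *\<^sub>R angle w))) x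
     - b * cos (\<omega> * U x)" for x
    using nonzero even_per_tri[OF ec, of x] even_per_tri[OF ew, of x]
    by (simp add: residual_def slope' angle bc_even_apply)
  have F: "flame_F (\<omega> *\<^sub>R h3_prim w) (1 + \<omega> * b) (\<alpha>\<^sub>0 + a) x = 0"
    if x: "weak_deriv (deriv (deriv (h3_fun (\<omega> *\<^sub>R h3_prim w)))) x = \<omega> * w x" for x
  proof -
    \<comment> \<open>J turns \<omega> times the reflected primitive into 1 - cos \<theta>; the two
      \<open>D\<^sub>0\<close> terms restore what the residual subtracts.\<close>
    have "flame_F (\<omega> *\<^sub>R h3_prim w) (1 + \<omega> * b) (\<alpha>\<^sub>0 + a) x
        = \<omega> * (D\<^sub>0 * residual \<omega> w a b x + D\<^sub>0 * w x + D\<^sub>0 * (real k)\<^sup>2 * V x)"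
      unfolding Dres flame_F_def x using J[of x]
      unfolding s h d
      by (simp add: algebra_simps power2_eq_square power3_eq_cube)
    also have "\<dots> = 0"
      unfolding wV[of x] by (simp add: algebra_simps)
    finally show ?thesis .
  qed
  have "admissible (\<omega> *\<^sub>R h3_prim w)"
    unfolding admissible_def h int using pos by simp
  moreover have "AE x in lborel. flame_F (\<omega> *\<^sub>R h3_prim w) (1 + \<omega> * b) (\<alpha>\<^sub>0 + a) x = 0"
    using ae by eventually_elim (rule F)
  ultimately show "flame_F_zero (\<omega> *\<^sub>R h3_prim w, 1 + \<omega> * b, \<alpha>\<^sub>0 + a)"
    by (simp add: flame_F_zero_def)
qed

end

section \<open>Traveling waves and the bifurcating curve\<close>

text \<open>The front is integrated from its tangent angle and translated with velocity (0, -
  \<beta>). The length formula makes x advance by 2 * pi; y closes up because sin \<theta> is odd.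
  Oddness is asked pointwise since \<open>sine_series\<close> speaks only of Fourier
  coefficients.\<close>

lemma flame_F_zero_imp_vertically_traveling:
  assumes "flame_F_zero (\<theta>, \<beta>, \<alpha>)" and odd: "odd_per (h3_fun \<theta>)"
  shows "vertically_traveling \<theta> \<beta> \<alpha>"
proof -
  define h where "h = h3_fun \<theta>"
  define s where "s = s_\<sigma> \<theta>"
  define I where "I = (LBINT \<sigma>:{0..2*pi}. cos (h \<sigma>))"
  have adm: "admissible \<theta>" and F: "AE \<sigma> in lborel. flame_F \<theta> \<beta> \<alpha> \<sigma> = 0"
    using assms(1) by (auto simp: flame_F_zero_def)
  have "I > 0" using adm by (simp add: admissible_def I_def h_def)
  have s: "s = 2 * pi / I"
    by (simp add: s_def s_\<sigma>_def front_length_def I_def h_def power2_eq_square)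
  have H: "h \<in> H3_per" using h3_fun[of \<theta>] by (simp add: h_def)
  then have diff: "\<And>x. h differentiable (at x)" "\<And>x. deriv h differentiable (at x)"
    by (auto simp: H3_per_def)
  have ch: "continuous_on UNIV h"
    using diff(1) by (simp add: continuous_at_imp_continuous_on differentiable_imp_continuous_within)
  have cc: "continuous_on UNIV (\<lambda>x. cos (h x))" and cs: "continuous_on UNIV (\<lambda>x. sin (h x))"
    by (intro continuous_intros ch)+
  have ec: "even_per (\<lambda>x. cos (h x))" and os: "odd_per (\<lambda>x. sin (h x))"
    using odd by (simp_all add: even_per_def odd_per_def h_def)
  have "AE \<sigma> in lborel. normal_velocity \<alpha> \<theta> \<sigma> = - \<beta> * cos (h \<sigma>)"
  proof -
    \<comment> \<open>The zero summand casts scaling by 1 / s in the form of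
      \<open>deriv_lincomb\<close> and \<open>is_weak_deriv_lincomb\<close>.\<close>
    have curv: "curvature \<theta> = (\<lambda>x. (1 / s) * deriv h x + 0 * deriv h x)"
      by (rule ext) (simp add: curvature_def h_def s_def)
    have cs: "curvature_s \<theta> = (\<lambda>x. (1 / s\<^sup>2) * deriv (deriv h) x + 0 * deriv (deriv h) x)"
      unfolding curvature_s_def[abs_def] curv deriv_lincomb[OF diff(2,2)]
      by (simp add: s_def power2_eq_square)
    note w = H3_per_L2(5)[OF H]
    have "is_weak_deriv (curvature_s \<theta>)
        (\<lambda>x. (1 / s\<^sup>2) * weak_deriv (deriv (deriv h)) x + 0 * weak_deriv (deriv (deriv h)) x)"
      unfolding cs by (rule is_weak_deriv_lincomb[OF w w])
    then have "AE \<sigma> in lborel. weak_deriv (curvature_s \<theta>) \<sigma>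
        = (1 / s\<^sup>2) * weak_deriv (deriv (deriv h)) \<sigma> + 0 * weak_deriv (deriv (deriv h)) \<sigma>"
      using is_weak_deriv_unique[OF is_weak_deriv_weak_deriv] by blast
    with F show ?thesis
    proof eventually_elim
      case (elim \<sigma>)
      then have css: "curvature_ss \<theta> \<sigma> = weak_deriv (deriv (deriv h)) \<sigma> / s ^ 3"
        by (simp add: curvature_ss_def s_def power2_eq_square power3_eq_cube)
      have "normal_velocity \<alpha> \<theta> \<sigma> = - (flame_F \<theta> \<beta> \<alpha> \<sigma> + \<beta> * cos (h \<sigma>))"
        unfolding normal_velocity_def css flame_F_def
        by (simp add: curvature_def h_def s_def power_divide)
      then show ?case using elim by simp
    qed
  qed
  note nv = this
  define x where "x \<sigma> t = s * prim (\<lambda>x. cos (h x)) \<sigma>" for \<sigma> t :: real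
  define y where "y \<sigma> t = s * prim (\<lambda>x. sin (h x)) \<sigma> - \<beta> * t" for \<sigma> t :: real
  define V where "V \<sigma> t = - \<beta> * sin (h \<sigma>)" for \<sigma> t :: real
  have xt: "((\<lambda>t. x \<sigma> t) has_real_derivative 0) (at t)"
    and yt: "((\<lambda>t. y \<sigma> t) has_real_derivative - \<beta>) (at t)" for \<sigma> t
    by (auto simp: x_def y_def intro!: derivative_eq_intros)
  have "x (\<sigma> + 2 * pi) t = x \<sigma> t + 2 * pi" for \<sigma> t
  proof -
    have 2: "prim (\<lambda>x. cos (h x)) (2 * pi) = I"
      unfolding I_def by (rule LBINT_eq_prim[symmetric]) (simp_all add: cc)
    have "prim (\<lambda>x. cos (h x)) \<sigma> = prim (\<lambda>x. cos (h x)) (\<sigma> + 2 * pi) - prim (\<lambda>x. cos (h x)) (2 * pi)"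
    proof (rule prim_eqI[OF cc])
      show "((\<lambda>\<sigma>. prim (\<lambda>x. cos (h x)) (\<sigma> + 2 * pi) - prim (\<lambda>x. cos (h x)) (2 * pi)) has_real_derivative cos (h x)) (at x)" for x
        using DERIV_diff[OF iffD1[OF DERIV_shift has_real_derivative_prim[OF cc, of "x + 2 * pi"]]
          DERIV_const[of "prim (\<lambda>x. cos (h x)) (2 * pi)"]] ec by (simp add: even_per_def)
    qed simp
    then have "prim (\<lambda>x. cos (h x)) (\<sigma> + 2 * pi) = prim (\<lambda>x. cos (h x)) \<sigma> + I"
      using 2 by simp
    then show ?thesis using \<open>I > 0\<close> by (simp add: x_def s distrib_left)
  qed
  moreover have "y (\<sigma> + 2 * pi) t = y \<sigma> t" for \<sigma> t
    using even_per_prim[OF cs os] by (simp add: y_def even_per_def)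
  moreover have "((\<lambda>\<sigma>. x \<sigma> t) has_real_derivative s * cos (h \<sigma>)) (at \<sigma>)"
    "((\<lambda>\<sigma>. y \<sigma> t) has_real_derivative s * sin (h \<sigma>)) (at \<sigma>)" for \<sigma> t
    by (auto simp: x_def y_def intro!: derivative_eq_intros has_real_derivative_prim cc cs)
  moreover have "AE \<sigma> in lborel.
        ((\<lambda>t. x \<sigma> t) has_real_derivative
           normal_velocity \<alpha> \<theta> \<sigma> * (- sin (h \<sigma>)) + V \<sigma> t * cos (h \<sigma>)) (at t) \<and>
        ((\<lambda>t. y \<sigma> t) has_real_derivative
           normal_velocity \<alpha> \<theta> \<sigma> * cos (h \<sigma>) + V \<sigma> t * sin (h \<sigma>)) (at t)" for t
    using nv
  proof eventually_elim
    case (elim \<sigma>)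
    have "- \<beta> * cos (h \<sigma>) * cos (h \<sigma>) + - \<beta> * sin (h \<sigma>) * sin (h \<sigma>)
        = - \<beta> * (cos (h \<sigma>) * cos (h \<sigma>) + sin (h \<sigma>) * sin (h \<sigma>))"
      by (simp only: distrib_left mult.assoc)
    also have "\<dots> = - \<beta>" unfolding sin_cos_squared_add3 by simp
    finally have "normal_velocity \<alpha> \<theta> \<sigma> * cos (h \<sigma>) + V \<sigma> t * sin (h \<sigma>) = - \<beta>"
      by (simp only: elim V_def)
    moreover have "normal_velocity \<alpha> \<theta> \<sigma> * (- sin (h \<sigma>)) + V \<sigma> t * cos (h \<sigma>) = 0"
      by (simp add: elim V_def)
    ultimately show ?case using xt yt by simp
  qed
  ultimately have "flame_front \<alpha> (\<lambda>_. \<theta>) V x y"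
    using adm by (simp add: flame_front_def h_def s_def)
  moreover have "\<forall>\<sigma> t. V \<sigma> t = - \<beta> * sin (h3_fun \<theta> \<sigma>)"
    by (simp add: V_def h_def)
  ultimately show ?thesis
    unfolding vertically_traveling_def using xt yt nv unfolding h_def by blast
qed

section \<open>The real root of q\<close>

lemma poly_flame_q: "poly (flame_q k) x = (x - 1) - x\<^sup>2 * (x + 3) * (real k)\<^sup>2"
  by (simp add: flame_q_def algebra_simps)

lemma pderiv_flame_q: "poly (pderiv (flame_q k)) x = 1 - (3 * x\<^sup>2 + 6 * x) * (real k)\<^sup>2"
  by (simp add: flame_q_def pderiv_diff pderiv_mult pderiv_power pderiv_pCons power2_eq_square algebra_simps)

text \<open>x^2 (x + 3) k^2 is nonnegative here, which settles x < 1; for x \<ge> 1 it is at least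
  x^2 \<ge> x > x - 1.\<close>

lemma flame_q_neg:
  assumes "k \<ge> 1" "x \<ge> - 3"
  shows "poly (flame_q k) x < 0"
proof -
  have k: "1 \<le> (real k)\<^sup>2" using assms by simp
  have "0 \<le> x\<^sup>2 * (x + 3)" using assms by simp
  then have 1: "x\<^sup>2 * (x + 3) * 1 \<le> x\<^sup>2 * (x + 3) * (real k)\<^sup>2"
    using k by (intro mult_left_mono)
  show ?thesis
  proof (cases "x < 1")
    case True
    then show ?thesis using 1 \<open>0 \<le> x\<^sup>2 * (x + 3)\<close> by (simp add: poly_flame_q)
  next
    case False
    then have "1 * x \<le> x * x" by (intro mult_right_mono) auto
    moreover have "x\<^sup>2 * 1 \<le> x\<^sup>2 * (x + 3)" using False by (intro mult_left_mono) auto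
    ultimately show ?thesis using 1 by (simp add: poly_flame_q power2_eq_square)
  qed
qed

text \<open>3 x^2 + 6 x - 9 = 3 (x + 3) (x - 1) is nonnegative left of -3, so the derivative is at
  most 1 - 9 k^2.\<close>

lemma pderiv_flame_q_neg:
  assumes "k \<ge> 1" "x \<le> - 3"
  shows "poly (pderiv (flame_q k)) x < 0"
proof -
  have "1 \<le> (real k)\<^sup>2" using assms by simp
  moreover have "9 \<le> 3 * x\<^sup>2 + 6 * x"
  proof -
    have "0 \<le> (- 3 - x) * (1 - x)" using assms by (intro mult_nonneg_nonneg) auto
    then show ?thesis by (simp add: power2_eq_square algebra_simps)
  qed
  ultimately have "9 * 1 \<le> (3 * x\<^sup>2 + 6 * x) * (real k)\<^sup>2" by (intro mult_mono) auto
  then show ?thesis by (simp add: pderiv_flame_q)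
qed

text \<open>All real roots lie left of -3, where q strictly decreases, so there is at most one and
  it is simple; q(-5) = 50 k^2 - 6 > 0 gives existence.\<close>

lemma flame_q_root:
  assumes k: "k \<ge> 1"
  obtains \<alpha> where "{x. poly (flame_q k) x = 0} = {\<alpha>}" "order \<alpha> (flame_q k) = 1"
    "poly (pderiv (flame_q k)) \<alpha> \<noteq> 0"
proof -
  have "flame_q k \<noteq> 0"
    using flame_q_neg[OF k, of 0] by auto
  have "1 \<le> (real k)\<^sup>2" using k by simp
  then have "(-5)\<^sup>2 * (-5 + 3) * (real k)\<^sup>2 \<le> (-50) * (1::real)" by simp
  then have "poly (flame_q k) (-5) > 0" by (simp add: poly_flame_q)
  moreover have "poly (flame_q k) (-3) < 0" by (rule flame_q_neg[OF k]) simp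
  ultimately obtain \<alpha> where \<alpha>: "-5 < \<alpha>" "\<alpha> < -3" "poly (flame_q k) \<alpha> = 0"
    using poly_IVT_neg[of "-5" "-3" "flame_q k"] by auto
  have "x = \<alpha>" if x: "poly (flame_q k) x = 0" for x
  proof -
    have "x < - 3" using flame_q_neg[OF k, of x] x by fastforce
    have no_pair: False if uv: "u < v" "v \<le> - 3" "poly (flame_q k) u = 0" "poly (flame_q k) v = 0" for u v
    proof -
      obtain z where "u < z" "z < v"
        "poly (flame_q k) v - poly (flame_q k) u = (v - u) * poly (pderiv (flame_q k)) z"
        using poly_MVT[OF uv(1), of "flame_q k"] by auto
      then show False using uv pderiv_flame_q_neg[OF k, of z] by auto
    qed
    then show ?thesis
      using \<alpha> x \<open>x < - 3\<close> no_pair[of x \<alpha>] no_pair[of \<alpha> x] by (cases x \<alpha> rule: linorder_cases) auto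
  qed
  then have "{x. poly (flame_q k) x = 0} = {\<alpha>}" using \<alpha>(3) by blast
  moreover have d: "poly (pderiv (flame_q k)) \<alpha> \<noteq> 0"
    using pderiv_flame_q_neg[OF k, of \<alpha>] \<alpha> by auto
  moreover have "order \<alpha> (flame_q k) = 1"
  proof -
    have "order \<alpha> (pderiv (flame_q k)) = 0" using d by (rule order_0I)
    then show ?thesis
      using order_pderiv[of "flame_q k" \<alpha>] \<alpha>(3) \<open>flame_q k \<noteq> 0\<close> by simp
  qed
  ultimately show thesis by (intro that)
qed

section \<open>The bifurcating curve and the conclusion\<close>

context flame_bifurcation
begin

text \<open>Pointwise oddness is recorded for the passage to traveling waves. A nonzero angle
  separates c \<omega> both from the trivial solutions and from c 0.\<close>

lemma bifurcating_curve:
  "\<exists>\<delta>>0. \<exists>c. c C1_differentiable_on {-\<delta><..<\<delta>} \<and> c 0 = (0, 1, \<alpha>\<^sub>0) \<and>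
    (\<forall>\<omega>\<in>{-\<delta><..<\<delta>}. flame_F_zero (c \<omega>) \<and> odd_per (h3_fun (fst (c \<omega>))) \<and>
       (\<omega> \<noteq> 0 \<longrightarrow> fst (c \<omega>) \<noteq> 0))"
proof -
  obtain \<delta> x where \<delta>: "\<delta> > 0" and x0: "x 0 = (- (real k)\<^sup>2 *\<^sub>R kos, 0, 0)"
    and fp: "\<And>\<omega>. \<bar>\<omega>\<bar> < \<delta> \<Longrightarrow> step (\<omega>, x \<omega>) = x \<omega>" and C1: "x C1_differentiable_on {-\<delta><..<\<delta>}"
    using C1_map_fixed_point_curve[OF C1_map_step step_0 step_deriv_0] by blast
  have C1p: "(\<lambda>\<omega>. (\<omega>, x \<omega>)) C1_differentiable_on {-\<delta><..<\<delta>}"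
  proof -
    obtain D where D: "\<And>t. t \<in> {-\<delta><..<\<delta>} \<Longrightarrow> (x has_vector_derivative D t) (at t)" "continuous_on {-\<delta><..<\<delta>} D"
      using C1 unfolding C1_differentiable_on_def by blast
    show ?thesis unfolding C1_differentiable_on_def
      by (rule exI[of _ "\<lambda>t. (1, D t)"]) (auto intro!: has_vector_derivative_Pair D continuous_intros)
  qed
  define c where "c \<omega> = (\<omega> *\<^sub>R h3_prim (fst (x \<omega>)), 1 + \<omega> * snd (snd (x \<omega>)), \<alpha>\<^sub>0 + fst (snd (x \<omega>)))" for \<omega>
  have "C1_map (\<lambda>p :: real \<times> (real \<Rightarrow>\<^sub>C real) \<times> real \<times> real.
      (fst p *\<^sub>R h3_prim (fst (snd p)), 1 + fst p * snd (snd (snd p)), \<alpha>\<^sub>0 + fst (snd (snd p))))"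
    by (intro C1_map_const C1_map_ident C1_map_add C1_map_Pair C1_map_scaleR C1_map_mult
      C1_map_linear_compose[OF bounded_linear_fst] C1_map_linear_compose[OF bounded_linear_snd]
      C1_map_linear_compose[OF bounded_linear_h3_prim])
  from C1_map_imp_C1_differentiable_on[OF this C1p]
  have C1c: "c C1_differentiable_on {-\<delta><..<\<delta>}"
    by (simp add: c_def[abs_def])
  have "C1_map (\<lambda>p :: real \<times> (real \<Rightarrow>\<^sub>C real) \<times> real \<times> real. inv_s (fst p) (fst (snd p)))"
    unfolding inv_s_def
    by (intro C1_map_ident C1_map_scaleR C1_map_compose[OF C1_map_bc_cos]
      C1_map_linear_compose[OF bounded_linear_fst] C1_map_linear_compose[OF bounded_linear_snd]
      C1_map_linear_compose[OF bounded_linear_mean] C1_map_linear_compose[OF bounded_linear_angle])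
  from C1_map_imp_C1_differentiable_on[OF this C1p]
  have "(\<lambda>\<omega>. inv_s \<omega> (fst (x \<omega>))) C1_differentiable_on {-\<delta><..<\<delta>}" by simp
  \<comment> \<open>\<open>inv_s\<close> is 1 at \<omega> = 0 for every w, so by continuity it is
    positive on a smaller interval, which yields \<open>admissible\<close>.\<close>
  then have "isCont (\<lambda>\<omega>. inv_s \<omega> (fst (x \<omega>))) 0"
    using C1_differentiable_imp_continuous_on continuous_on_interior[of "{-\<delta><..<\<delta>}" _ 0] \<delta> by force
  moreover have "inv_s 0 w = 1" for w
  proof -
    have "bc_compose cos 0 = bc_one" by (rule bcontfun_eqI) simp
    then show ?thesis by (simp add: inv_s_def mean_one)
  qed
  ultimately have "\<forall>\<^sub>F \<omega> in at 0. inv_s \<omega> (fst (x \<omega>)) > 0"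
    unfolding isCont_def by (intro order_tendstoD(1)) auto
  then obtain \<delta>' where \<delta>': "\<delta>' > 0" "\<And>\<omega>. \<omega> \<noteq> 0 \<Longrightarrow> \<bar>\<omega>\<bar> < \<delta>' \<Longrightarrow> inv_s \<omega> (fst (x \<omega>)) > 0"
    unfolding eventually_at by (auto simp: dist_real_def)
  have pos: "inv_s \<omega> (fst (x \<omega>)) > 0" if "\<bar>\<omega>\<bar> < \<delta>'" for \<omega>
    using \<delta>'(2)[OF _ that] \<open>\<And>w. inv_s 0 w = 1\<close> by (cases "\<omega> = 0") auto
  define d where "d = min \<delta> \<delta>'"
  have sol: "flame_F_zero (c \<omega>)" "odd_per (h3_fun (fst (c \<omega>)))" "\<omega> \<noteq> 0 \<Longrightarrow> fst (c \<omega>) \<noteq> 0"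
    if "\<omega> \<in> {-d<..<d}" for \<omega>
  proof -
    have \<omega>: "\<bar>\<omega>\<bar> < \<delta>" "\<bar>\<omega>\<bar> < \<delta>'" using that by (auto simp: d_def)
    obtain w a b where w: "x \<omega> = (w, a, b)" by (cases "x \<omega>")
    have "step (\<omega>, w, a, b) = (w, a, b)" "inv_s \<omega> w > 0"
      using fp[OF \<omega>(1)] pos[OF \<omega>(2)] by (simp_all only: w fst_conv)
    note sol = step_fixed_point_solution[OF this]
    show "flame_F_zero (c \<omega>)" "odd_per (h3_fun (fst (c \<omega>)))" "\<omega> \<noteq> 0 \<Longrightarrow> fst (c \<omega>) \<noteq> 0"
      unfolding c_def w fst_conv snd_conv by (fact sol)+
  qed
  show ?thesis
  proof (intro exI[of _ d] exI[of _ c] conjI ballI impI)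
    show "d > 0" using \<delta> \<delta>' by (simp add: d_def)
    show "c C1_differentiable_on {-d<..<d}"
      using C1c by (rule C1_differentiable_on_subset) (auto simp: d_def)
    show "c 0 = (0, 1, \<alpha>\<^sub>0)" by (simp add: c_def x0)
  qed (rule sol, assumption+)+
qed

end

theorem theorem3:
  fixes k\<^sub>0 :: nat
  assumes "k\<^sub>0 \<ge> 1"
  shows "\<exists>\<alpha>\<^sub>0. {\<alpha>. poly (flame_q k\<^sub>0) \<alpha> = 0} = {\<alpha>\<^sub>0} \<and> order \<alpha>\<^sub>0 (flame_q k\<^sub>0) = 1 \<and>
    (\<forall>\<epsilon>>0. infinite {(\<theta>, \<beta>, \<alpha>). (\<theta>, \<beta>, \<alpha>) \<in> ball (0, 1, \<alpha>\<^sub>0) \<epsilon> \<and>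
        (\<theta>, \<beta>, \<alpha>) \<notin> trivial_solutions \<and> vertically_traveling \<theta> \<beta> \<alpha>}) \<and>
    (\<exists>\<delta>>0. \<exists>c :: real \<Rightarrow> h3_odd \<times> real \<times> real.
        c C1_differentiable_on {-\<delta><..<\<delta>} \<and> c 0 = (0, 1, \<alpha>\<^sub>0) \<and>
        (\<forall>\<omega>\<in>{-\<delta><..<\<delta>}. \<omega> \<noteq> 0 \<longrightarrow> c \<omega> \<notin> trivial_solutions) \<and>
        (\<forall>\<omega>\<in>{-\<delta><..<\<delta>}. flame_F_zero (c \<omega>)))"
proof -
  obtain \<alpha>\<^sub>0 where q_root: "{\<alpha>. poly (flame_q k\<^sub>0) \<alpha> = 0} = {\<alpha>\<^sub>0}" "order \<alpha>\<^sub>0 (flame_q k\<^sub>0) = 1"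
    and d: "poly (pderiv (flame_q k\<^sub>0)) \<alpha>\<^sub>0 \<noteq> 0"
    using flame_q_root[OF assms] by blast
  have "poly (flame_q k\<^sub>0) \<alpha>\<^sub>0 = 0" using q_root(1) by blast
  then interpret flame_bifurcation k\<^sub>0 \<alpha>\<^sub>0
    using assms d by unfold_locales (simp_all add: poly_flame_q pderiv_flame_q)
  obtain \<delta> c where \<delta>: "\<delta> > 0" and C1: "c C1_differentiable_on {-\<delta><..<\<delta>}" and c0: "c 0 = (0, 1, \<alpha>\<^sub>0)"
    and curve: "\<forall>\<omega>\<in>{-\<delta><..<\<delta>}. flame_F_zero (c \<omega>) \<and> odd_per (h3_fun (fst (c \<omega>))) \<and>
       (\<omega> \<noteq> 0 \<longrightarrow> fst (c \<omega>) \<noteq> 0)"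
    using bifurcating_curve by metis
  then have F: "flame_F_zero (c \<omega>)" and odd: "odd_per (h3_fun (fst (c \<omega>)))"
    and ne: "\<omega> \<noteq> 0 \<Longrightarrow> fst (c \<omega>) \<noteq> 0" if "\<omega> \<in> {-\<delta><..<\<delta>}" for \<omega>
    using that by blast+
  have nontriv: "c \<omega> \<notin> trivial_solutions" if "\<omega> \<in> {-\<delta><..<\<delta>}" "\<omega> \<noteq> 0" for \<omega>
    using ne[OF that] by (auto simp: trivial_solutions_def)
  have "infinite {(\<theta>, \<beta>, \<alpha>). (\<theta>, \<beta>, \<alpha>) \<in> ball (0, 1, \<alpha>\<^sub>0) \<epsilon> \<and>
        (\<theta>, \<beta>, \<alpha>) \<notin> trivial_solutions \<and> vertically_traveling \<theta> \<beta> \<alpha>}" (is "infinite ?S") if "\<epsilon> > 0" for \<epsilon>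
  proof
    \<comment> \<open>No injectivity of c is used: points of the set other than c 0 accumulate at c
      0, whereas a finite set would keep a distance e from it.\<close>
    assume "finite ?S"
    from finite_set_avoid[OF this, of "c 0"]
    obtain e where e: "e > 0" "\<forall>p\<in>?S. p \<noteq> c 0 \<longrightarrow> e \<le> dist (c 0) p" by (elim exE conjE)
    have "continuous_on {-\<delta><..<\<delta>} c"
      by (rule C1_differentiable_imp_continuous_on[OF C1])
    then have "isCont c 0" using \<delta> by (intro continuous_on_interior) auto
    then have "\<forall>\<^sub>F \<omega> in at 0. dist (c \<omega>) (c 0) < min e \<epsilon>"
      unfolding isCont_def using e(1) \<open>\<epsilon> > 0\<close> by (intro tendstoD) auto
    moreover have "\<forall>\<^sub>F \<omega> in at 0. \<omega> \<in> {-\<delta><..<\<delta>}"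
      using \<delta> by (intro eventually_at_in_open') auto
    moreover have "\<forall>\<^sub>F \<omega> in at (0::real). \<omega> \<noteq> 0"
      by (simp add: eventually_at_filter)
    ultimately have "\<forall>\<^sub>F \<omega> in at (0::real). False"
    proof eventually_elim
      case (elim \<omega>)
      obtain \<theta> \<beta> \<alpha> where c: "c \<omega> = (\<theta>, \<beta>, \<alpha>)" by (cases "c \<omega>")
      have "vertically_traveling \<theta> \<beta> \<alpha>"
        using flame_F_zero_imp_vertically_traveling F[OF elim(2)] odd[OF elim(2)] by (simp add: c)
      moreover have "c \<omega> \<in> ball (c 0) \<epsilon>" using elim(1) by (simp add: dist_commute)
      ultimately have mem: "c \<omega> \<in> ?S"
        using nontriv[OF elim(2,3)] by (simp add: c c0)
      have "c \<omega> \<noteq> c 0"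
        using ne[OF elim(2,3)] c0 by (metis fst_conv)
      then have "e \<le> dist (c 0) (c \<omega>)" by (rule e(2)[THEN bspec, OF mem, THEN mp])
      then show False using elim(1) by (simp add: dist_commute)
    qed
    then show False by simp
  qed
  note inf = this
  show ?thesis
  proof (rule exI[of _ \<alpha>\<^sub>0], intro conjI allI impI)
    show "\<exists>\<delta>>0. \<exists>c :: real \<Rightarrow> h3_odd \<times> real \<times> real.
        c C1_differentiable_on {-\<delta><..<\<delta>} \<and> c 0 = (0, 1, \<alpha>\<^sub>0) \<and>
        (\<forall>\<omega>\<in>{-\<delta><..<\<delta>}. \<omega> \<noteq> 0 \<longrightarrow> c \<omega> \<notin> trivial_solutions) \<and>
        (\<forall>\<omega>\<in>{-\<delta><..<\<delta>}. flame_F_zero (c \<omega>))"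
      by (rule exI[of _ \<delta>], rule conjI[OF \<delta>], rule exI[of _ c]) (use C1 c0 nontriv F in simp)
  qed (rule q_root inf, assumption?)+
qed

end
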